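(* Let $\mathcal C_1=(\mathcal S_1,\mathfrak B_1,\mu_1)$ and $\mathcal C_2=(\mathcal S_2,\mathfrak B_2,\mu_2)$ be content spaces, let $\phi:\mathcal S_1\to\mathcal S_2$ be a content space morphism, and let $\phi^*:\mathcal S_1^*\to\mathcal S_2^*$ be the function induced by $\phi^{-1}:\mathfrak B_2\to\mathfrak B_1$ via Stone duality. Then $\phi^*$ is a continuous, measure-preserving function from $\mathcal C_1^*$ to $\mathcal C_2^*$. The transformation $\sigma$ defined by $\mathcal C\mapsto\mathcal C^*$ and $\phi\mapsto\phi^*$ is a faithful functor from $\mathbf{Cont}$ to $\mathbf{StPr}$.
   Context: For a topological space $\mathcal T$, an open set $R\subseteq\mathcal T$ is regular if $R=\mathrm{int}(\mathrm{clos}(R))$. $\mathfrak R(\mathcal T)$ is the set of regular open subsets; it is a Boolean algebra with meet $\cap$, join $Q\vee R:=\mathrm{int}(\mathrm{clos}(Q\cup R))$ and complement $\neg R:=\mathrm{int}(\mathcal T\setminus R)$. A Boolean subalgebra is a subset closed under $\cap,\vee,\neg$. A content on $\mathfrak B\subseteq\mathfrak R(\mathcal S)$ is a function $\mu:\mathfrak B\to[0,\infty)$ such that $\mu[B_1\vee\cdots\vee B_N]=\sum_n\mu[B_n]$ for every finite collection of disjoint elements of $\mathfrak B$. For $\mathcal S$ locally compact Hausdorff with Stone-Čech compactification $\widehat{\mathcal S}$, each $R\in\mathfrak R(\mathcal S)$ has a unique $\widehat R\in\mathfrak R(\widehat{\mathcal S})$ with $\widehat R\cap\mathcal S=R$.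 A Boolean subalgebra $\mathfrak B\subseteq\mathfrak R(\mathcal S)$ is generative if $\{\widehat B: B\in\mathfrak B\}$ is a base for the topology of $\widehat{\mathcal S}$. A content space is a triple $(\mathcal S,\mathfrak B,\mu)$ where $\mathcal S$ is locally compact Hausdorff, $\mathfrak B$ is a generative Boolean subalgebra of $\mathfrak R(\mathcal S)$, and $\mu$ is a content on $\mathfrak B$ with $\mu[\mathcal S]=1$. A morphism from $(\mathcal S_1,\mathfrak B_1,\mu_1)$ to $(\mathcal S_2,\mathfrak B_2,\mu_2)$ is a continuous $\phi:\mathcal S_1\to\mathcal S_2$ such that $B\mapsto\phi^{-1}(B)$ is a Boolean algebra homomorphism $\mathfrak B_2\to\mathfrak B_1$ and $\mu_1[\phi^{-1}(B)]=\mu_2[B]$ for all $B\in\mathfrak B_2$. $\mathbf{Cont}$ is the category of content spaces and their morphisms. A Stonean space is a compact, totally disconnected Hausdorff space. A Borel probability measure is a countably additive probability measure on the Borel sigma-algebra. A Stonean probability space is a pair $(\mathcal S,\mu)$ with $\mathcal S$ a Stonean space and $\mu$ a Borel probability measure on $\mathcal S$; $\mathbf{StPr}$ is the category of Stonean probability spaces and continuous, measure-preserving functions. For a content space $\mathcal C=(\mathcal S,\mathfrak B,\mu)$, $\mathcal S^*:=\sigma(\mathfrak B)$ is the Stone space of $\mathfrak B$: the set of ultrafilters of $\mathfrak B$ with base of clopen sets $B^*:=\{s^*: B\in s^*\}$, $B\in\mathfrak B$. $\mu^*$ is the unique Borel probability measure on $\mathcal S^*$ with $\mu^*[B^*]=\mu[B]$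 for all $B\in\mathfrak B$. The Stone representation of $\mathcal C$ is $\mathcal C^*:=(\mathcal S^*,\mu^* )$. For a morphism $\phi$, $\phi^*(s_1^* ):=\{B\in\mathfrak B_2:\phi^{-1}(B)\in s_1^*\}$.
   Formalization: The measure μ* is taken to be the unique inner regular Borel probability measure with μ*[B*]=μ[B]; without regularity uniqueness fails, e.g. for clopen sets of [0,ω₁] with μ[B]=1 iff ω₁∈B (Dirac and Dieudonné measures). *)

theory Defs
  imports "HOL-Probability.Probability"
begin

section \<open>Regular open sets\<close>

definition regular_opens :: "'a topology \<Rightarrow> 'a set set" where
  "regular_opens X = {R. openin X R \<and> R = X interior_of (X closure_of R)}"

definition ro_join :: "'a topology \<Rightarrow> 'a set \<Rightarrow> 'a set \<Rightarrow> 'a set" where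
  "ro_join X Q R = X interior_of (X closure_of (Q \<union> R))"

definition ro_compl :: "'a topology \<Rightarrow> 'a set \<Rightarrow> 'a set" where
  "ro_compl X R = X interior_of (topspace X - R)"

text \<open>Nonemptiness is what makes the bottom and top elements members.\<close>

definition boolean_subalgebra :: "'a topology \<Rightarrow> 'a set set \<Rightarrow> bool" where
  "boolean_subalgebra X \<BB> \<longleftrightarrow>
     \<BB> \<subseteq> regular_opens X \<and> \<BB> \<noteq> {} \<and>
     (\<forall>Q\<in>\<BB>. \<forall>R\<in>\<BB>. Q \<inter> R \<in> \<BB> \<and> ro_join X Q R \<in> \<BB>) \<and>
     (\<forall>R\<in>\<BB>. ro_compl X R \<in> \<BB>)"

definition boolean_hom ::
  "'a topology \<Rightarrow> 'a set set \<Rightarrow> 'b topology \<Rightarrow> 'b set set \<Rightarrow> ('a set \<Rightarrow> 'b set) \<Rightarrow> bool" where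
  "boolean_hom X \<BB> Y \<CC> h \<longleftrightarrow>
     h \<in> \<BB> \<rightarrow> \<CC> \<and>
     (\<forall>Q\<in>\<BB>. \<forall>R\<in>\<BB>. h (Q \<inter> R) = h Q \<inter> h R \<and> h (ro_join X Q R) = ro_join Y (h Q) (h R)) \<and>
     (\<forall>R\<in>\<BB>. h (ro_compl X R) = ro_compl Y (h R))"

text \<open>Finite families are lists, so that an element may be repeated; only the empty set can be,
  by disjointness. The empty list forces \<open>\<mu> {} = 0\<close>, as the list \<open>[{}, {}]\<close> does anyway.
  A function on \<open>\<BB>\<close> is made a total one by the convention of \<open>PiE\<close>: it is \<open>undefined\<close>
  outside \<open>\<BB>\<close>.\<close>

definition is_content :: "'a topology \<Rightarrow> 'a set set \<Rightarrow> ('a set \<Rightarrow> real) \<Rightarrow> bool" where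
  "is_content X \<BB> \<mu> \<longleftrightarrow>
     \<mu> \<in> \<BB> \<rightarrow>\<^sub>E {0..} \<and>
     (\<forall>Bs. set Bs \<subseteq> \<BB> \<and> sorted_wrt disjnt Bs \<longrightarrow>
        \<mu> (foldr (ro_join X) Bs {}) = sum_list (map \<mu> Bs))"


section \<open>The Stone-Cech compactification\<close>

text \<open>The closure of the canonical image of \<open>X\<close> in the cube indexed by all continuous
  functions from \<open>X\<close> to the unit interval. For completely regular Hausdorff \<open>X\<close>, in particular
  for locally compact Hausdorff \<open>X\<close>, the map \<open>sc_unit X\<close> is an embedding
  (\<open>completely_regular_space_cube_embedding_explicit\<close>).\<close>

definition unit_functions :: "'a topology \<Rightarrow> ('a \<Rightarrow> real) set" where
  "unit_functions X = {f \<in> topspace X \<rightarrow>\<^sub>E {0..1}. continuous_map X euclideanreal f}"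

definition sc_unit :: "'a topology \<Rightarrow> 'a \<Rightarrow> (('a \<Rightarrow> real) \<Rightarrow> real)" where
  "sc_unit X x = (\<lambda>f\<in>unit_functions X. f x)"

definition sc_cube :: "'a topology \<Rightarrow> (('a \<Rightarrow> real) \<Rightarrow> real) topology" where
  "sc_cube X = product_topology (\<lambda>f. top_of_set {0..1}) (unit_functions X)"

definition stone_cech :: "'a topology \<Rightarrow> (('a \<Rightarrow> real) \<Rightarrow> real) topology" where
  "stone_cech X = subtopology (sc_cube X) (sc_cube X closure_of (sc_unit X ` topspace X))"

text \<open>As \<open>X\<close> sits in \<open>stone_cech X\<close> via \<open>sc_unit X\<close>, the trace of \<open>Q\<close> on \<open>X\<close> is
  the preimage of \<open>Q\<close> under \<open>sc_unit X\<close>.\<close>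

definition sc_extension :: "'a topology \<Rightarrow> 'a set \<Rightarrow> (('a \<Rightarrow> real) \<Rightarrow> real) set" where
  "sc_extension X R =
     (THE Q. Q \<in> regular_opens (stone_cech X) \<and> sc_unit X -` Q \<inter> topspace X = R)"

definition generative :: "'a topology \<Rightarrow> 'a set set \<Rightarrow> bool" where
  "generative X \<BB> \<longleftrightarrow>
     openin (stone_cech X) = arbitrary union_of (\<lambda>U. U \<in> sc_extension X ` \<BB>)"


section \<open>Content spaces\<close>

record 'a content_triple =
  pts :: "'a topology"
  alg :: "'a set set"
  cont :: "'a set \<Rightarrow> real"

definition content_space :: "'a content_triple \<Rightarrow> bool" where
  "content_space C \<longleftrightarrow>
     locally_compact_space (pts C) \<and> Hausdorff_space (pts C) \<and>
     boolean_subalgebra (pts C) (alg C) \<and> generative (pts C) (alg C) \<and>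
     is_content (pts C) (alg C) (cont C) \<and> cont C (topspace (pts C)) = 1"

definition content_preimage :: "'a content_triple \<Rightarrow> ('a \<Rightarrow> 'b) \<Rightarrow> 'b set \<Rightarrow> 'a set" where
  "content_preimage C \<phi> B = \<phi> -` B \<inter> topspace (pts C)"

definition content_morphism :: "'a content_triple \<Rightarrow> 'b content_triple \<Rightarrow> ('a \<Rightarrow> 'b) \<Rightarrow> bool" where
  "content_morphism C1 C2 \<phi> \<longleftrightarrow>
     continuous_map (pts C1) (pts C2) \<phi> \<and>
     boolean_hom (pts C2) (alg C2) (pts C1) (alg C1) (content_preimage C1 \<phi>) \<and>
     (\<forall>B\<in>alg C2. cont C1 (content_preimage C1 \<phi> B) = cont C2 B)"


section \<open>Stonean probability spaces\<close>

definition stonean_space :: "'a topology \<Rightarrow> bool" where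
  "stonean_space X \<longleftrightarrow> compact_space X \<and> Hausdorff_space X \<and>
     (\<forall>S. connectedin X S \<longrightarrow> (\<exists>a. S \<subseteq> {a}))"

definition borel_probability :: "'a topology \<Rightarrow> 'a measure \<Rightarrow> bool" where
  "borel_probability X M \<longleftrightarrow> prob_space M \<and> sets M = sigma_sets (topspace X) {U. openin X U}"

type_synonym 'a top_measure = "'a topology \<times> 'a measure"

definition stonean_prob_space :: "'a top_measure \<Rightarrow> bool" where
  "stonean_prob_space P \<longleftrightarrow> stonean_space (fst P) \<and> borel_probability (fst P) (snd P)"

definition measure_preserving :: "'a measure \<Rightarrow> 'b measure \<Rightarrow> ('a \<Rightarrow> 'b) \<Rightarrow> bool" where
  "measure_preserving M N f \<longleftrightarrow>
     f \<in> measurable M N \<and> (\<forall>A\<in>sets N. emeasure M (f -` A \<inter> space M) = emeasure N A)"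

definition stonean_morphism :: "'a top_measure \<Rightarrow> 'b top_measure \<Rightarrow> ('a \<Rightarrow> 'b) \<Rightarrow> bool" where
  "stonean_morphism P Q f \<longleftrightarrow>
     continuous_map (fst P) (fst Q) f \<and> measure_preserving (snd P) (snd Q) f"


section \<open>The Stone representation\<close>

definition proper_filter :: "'a topology \<Rightarrow> 'a set set \<Rightarrow> 'a set set \<Rightarrow> bool" where
  "proper_filter X \<BB> F \<longleftrightarrow>
     F \<subseteq> \<BB> \<and> topspace X \<in> F \<and> {} \<notin> F \<and>
     (\<forall>A\<in>F. \<forall>B\<in>F. A \<inter> B \<in> F) \<and>
     (\<forall>A\<in>F. \<forall>B\<in>\<BB>. A \<subseteq> B \<longrightarrow> B \<in> F)"

definition ultrafilters :: "'a topology \<Rightarrow> 'a set set \<Rightarrow> 'a set set set" where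
  "ultrafilters X \<BB> =
     {F. proper_filter X \<BB> F \<and> (\<forall>G. proper_filter X \<BB> G \<and> F \<subseteq> G \<longrightarrow> G = F)}"

definition star_set :: "'a content_triple \<Rightarrow> 'a set \<Rightarrow> 'a set set set" where
  "star_set C B = {s \<in> ultrafilters (pts C) (alg C). B \<in> s}"

text \<open>The generating sets are closed under finite intersection and cover all ultrafilters, so
  they are a base and not only a subbase.\<close>

definition stone_space :: "'a content_triple \<Rightarrow> 'a set set topology" where
  "stone_space C = topology_generated_by (star_set C ` alg C)"

definition inner_regular :: "'a topology \<Rightarrow> 'a measure \<Rightarrow> bool" where
  "inner_regular X M \<longleftrightarrow>
     (\<forall>A\<in>sets M. emeasure M A = (SUP K\<in>{K. compactin X K \<and> K \<subseteq> A}. emeasure M K))"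

text \<open>A content on the clopen sets of a Stone space has exactly one inner regular Borel
  extension. Regularity cannot be dropped: on the Stone space \<open>[0, \<omega>\<^sub>1]\<close> the
  Dirac measure at \<open>\<omega>\<^sub>1\<close> and the Dieudonne measure agree on all clopen sets.\<close>

definition stone_measure :: "'a content_triple \<Rightarrow> 'a set set measure" where
  "stone_measure C =
     (THE M. borel_probability (stone_space C) M \<and> inner_regular (stone_space C) M \<and>
        (\<forall>B\<in>alg C. measure M (star_set C B) = cont C B))"

definition stone_rep :: "'a content_triple \<Rightarrow> 'a set set top_measure" where
  "stone_rep C = (stone_space C, stone_measure C)"

definition stone_map ::
  "'a content_triple \<Rightarrow> 'b content_triple \<Rightarrow> ('a \<Rightarrow> 'b) \<Rightarrow> 'a set set \<Rightarrow> 'b set set" where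
  "stone_map C1 C2 \<phi> =
     (\<lambda>s\<in>ultrafilters (pts C1) (alg C1). {B \<in> alg C2. content_preimage C1 \<phi> B \<in> s})"


section \<open>Categories and functors\<close>

text \<open>Hom-sets need not be disjoint, so composition, identities and the action of a functor on
  morphisms take the objects as arguments: \<open>Comp \<A> A B C g f\<close> composes
  \<open>f \<in> Hom \<A> A B\<close> with \<open>g \<in> Hom \<A> B C\<close>.\<close>

record ('o, 'm) cat =
  Obj :: "'o set"
  Hom :: "'o \<Rightarrow> 'o \<Rightarrow> 'm set"
  Ident :: "'o \<Rightarrow> 'm"
  Comp :: "'o \<Rightarrow> 'o \<Rightarrow> 'o \<Rightarrow> 'm \<Rightarrow> 'm \<Rightarrow> 'm"

definition is_category :: "('o, 'm) cat \<Rightarrow> bool" where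
  "is_category \<A> \<longleftrightarrow>
     (\<forall>A\<in>Obj \<A>. Ident \<A> A \<in> Hom \<A> A A) \<and>
     (\<forall>A\<in>Obj \<A>. \<forall>B\<in>Obj \<A>. \<forall>C\<in>Obj \<A>. \<forall>f\<in>Hom \<A> A B. \<forall>g\<in>Hom \<A> B C.
        Comp \<A> A B C g f \<in> Hom \<A> A C) \<and>
     (\<forall>A\<in>Obj \<A>. \<forall>B\<in>Obj \<A>. \<forall>f\<in>Hom \<A> A B.
        Comp \<A> A A B f (Ident \<A> A) = f \<and> Comp \<A> A B B (Ident \<A> B) f = f) \<and>
     (\<forall>A\<in>Obj \<A>. \<forall>B\<in>Obj \<A>. \<forall>C\<in>Obj \<A>. \<forall>D\<in>Obj \<A>.
        \<forall>f\<in>Hom \<A> A B. \<forall>g\<in>Hom \<A> B C. \<forall>h\<in>Hom \<A> C D.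
        Comp \<A> A C D h (Comp \<A> A B C g f) = Comp \<A> A B D (Comp \<A> B C D h g) f)"

definition is_functor ::
  "('o, 'm) cat \<Rightarrow> ('p, 'n) cat \<Rightarrow> ('o \<Rightarrow> 'p) \<Rightarrow> ('o \<Rightarrow> 'o \<Rightarrow> 'm \<Rightarrow> 'n) \<Rightarrow> bool" where
  "is_functor \<A> \<D> F Fm \<longleftrightarrow>
     is_category \<A> \<and> is_category \<D> \<and>
     (\<forall>A\<in>Obj \<A>. F A \<in> Obj \<D>) \<and>
     (\<forall>A\<in>Obj \<A>. \<forall>B\<in>Obj \<A>. \<forall>f\<in>Hom \<A> A B. Fm A B f \<in> Hom \<D> (F A) (F B)) \<and>
     (\<forall>A\<in>Obj \<A>. Fm A A (Ident \<A> A) = Ident \<D> (F A)) \<and>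
     (\<forall>A\<in>Obj \<A>. \<forall>B\<in>Obj \<A>. \<forall>C\<in>Obj \<A>. \<forall>f\<in>Hom \<A> A B. \<forall>g\<in>Hom \<A> B C.
        Fm A C (Comp \<A> A B C g f) = Comp \<D> (F A) (F B) (F C) (Fm B C g) (Fm A B f))"

definition faithful_functor ::
  "('o, 'm) cat \<Rightarrow> ('p, 'n) cat \<Rightarrow> ('o \<Rightarrow> 'p) \<Rightarrow> ('o \<Rightarrow> 'o \<Rightarrow> 'm \<Rightarrow> 'n) \<Rightarrow> bool" where
  "faithful_functor \<A> \<D> F Fm \<longleftrightarrow>
     is_functor \<A> \<D> F Fm \<and> (\<forall>A\<in>Obj \<A>. \<forall>B\<in>Obj \<A>. inj_on (Fm A B) (Hom \<A> A B))"

text \<open>Morphisms are restricted to the points of their domain (and \<open>undefined\<close> elsewhere), so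
  that equality in a hom-set is equality of functions between the underlying sets.\<close>

definition Cont :: "('a content_triple, 'a \<Rightarrow> 'a) cat" where
  "Cont = \<lparr>
     Obj = {C. content_space C},
     Hom = (\<lambda>C1 C2. {\<phi> \<in> extensional (topspace (pts C1)). content_morphism C1 C2 \<phi>}),
     Ident = (\<lambda>C. \<lambda>x\<in>topspace (pts C). x),
     Comp = (\<lambda>C1 C2 C3 \<psi> \<phi>. compose (topspace (pts C1)) \<psi> \<phi>)\<rparr>"

definition StPr :: "('a top_measure, 'a \<Rightarrow> 'a) cat" where
  "StPr = \<lparr>
     Obj = {P. stonean_prob_space P},
     Hom = (\<lambda>P Q. {f \<in> extensional (topspace (fst P)). stonean_morphism P Q f}),
     Ident = (\<lambda>P. \<lambda>x\<in>topspace (fst P). x),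
     Comp = (\<lambda>P Q R g f. compose (topspace (fst P)) g f)\<rparr>"

end

theory Submission
  imports Defs
begin

text \<open>
  An element of a Boolean subalgebra is determined by the ultrafilters containing it, and the
  Stone map pulls \<open>B\<^sup>*\<close> back to \<open>(\<phi>\<^sup>-\<^sup>1 B)\<^sup>*\<close>; this gives continuity and the
  functor laws. An inner regular measure on a zero-dimensional compact space is determined by its
  values on a clopen base: a compact subset of an open set \<open>U\<close> lies in a basic clopen subset of
  \<open>U\<close>, so the measure of \<open>U\<close> is the supremum over basic clopen subsets. The same supremum,
  turned into an outer measure, yields existence. Images of compact sets being compact, the image of
  \<open>\<mu>\<^sub>1\<^sup>*\<close> under \<open>\<phi>\<^sup>*\<close> is inner regular with the values of \<open>\<mu>\<^sub>2\<^sup>*\<close>, hence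
  equal to it. For faithfulness, equality of the Stone maps forces equality of all preimages, and a
  generative algebra separates points because the Stone-Cech compactification is Hausdorff.
\<close>

section \<open>Inner regular extension of a premeasure on clopen sets\<close>

text \<open>Abstracts from the Stone space of a Boolean algebra. Members of \<open>\<A>\<close> are
  clopen because their complements are members too. Only finite additivity is assumed of
  \<open>\<nu>\<close>; compactness supplies the countable part.\<close>

locale clopen_premeasure =
  fixes X :: "'a topology" and \<A> :: "'a set set" and \<nu> :: "'a set \<Rightarrow> ennreal"
  assumes compact: "compact_space X"
    and algebra: "algebra (topspace X) \<A>"
    and open_alg: "A \<in> \<A> \<Longrightarrow> openin X A"
    and base: "openin X U \<Longrightarrow> x \<in> U \<Longrightarrow> \<exists>A\<in>\<A>. x \<in> A \<and> A \<subseteq> U"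
    and positive: "positive \<A> \<nu>" and additive: "additive \<A> \<nu>"
    and finite: "\<nu> (topspace X) \<noteq> \<infinity>"
begin

sublocale alg: algebra "topspace X" \<A> by (fact algebra)

lemma closed_alg: "A \<in> \<A> \<Longrightarrow> closedin X A"
  using alg.compl_sets alg.sets_into_space open_alg by (force simp: closedin_def)

lemma mono: "A \<in> \<A> \<Longrightarrow> B \<in> \<A> \<Longrightarrow> A \<subseteq> B \<Longrightarrow> \<nu> A \<le> \<nu> B"
  using alg.additive_increasing[OF positive additive] by (auto simp: increasing_def)

text \<open>This is the only value that an inner regular extension of \<open>\<nu>\<close> can give
  to an open set, by \<open>inner_regular_open\<close>.\<close>

definition open_content :: "'a set \<Rightarrow> ennreal" where
  "open_content U = (SUP A\<in>{A\<in>\<A>. A \<subseteq> U}. \<nu> A)"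

definition outer_content :: "'a set \<Rightarrow> ennreal" where
  "outer_content S = (INF U\<in>{U. openin X U \<and> S \<subseteq> U}. open_content U)"

lemma open_content_upper: "A \<in> \<A> \<Longrightarrow> A \<subseteq> U \<Longrightarrow> \<nu> A \<le> open_content U"
  unfolding open_content_def by (rule SUP_upper) auto

lemma open_content_least: "(\<And>A. A \<in> \<A> \<Longrightarrow> A \<subseteq> U \<Longrightarrow> \<nu> A \<le> c) \<Longrightarrow> open_content U \<le> c"
  unfolding open_content_def by (rule SUP_least) auto

lemma open_content_mono: "U \<subseteq> V \<Longrightarrow> open_content U \<le> open_content V"
  by (intro open_content_least open_content_upper) auto

lemma open_content_eq: "A \<in> \<A> \<Longrightarrow> open_content A = \<nu> A"
  by (intro antisym open_content_least open_content_upper mono) auto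

lemma outer_content_lower: "openin X U \<Longrightarrow> S \<subseteq> U \<Longrightarrow> outer_content S \<le> open_content U"
  unfolding outer_content_def by (rule INF_lower) auto

lemma outer_content_greatest: "(\<And>U. openin X U \<Longrightarrow> S \<subseteq> U \<Longrightarrow> c \<le> open_content U) \<Longrightarrow> c \<le> outer_content S"
  unfolding outer_content_def by (rule INF_greatest) auto

lemma outer_content_mono: "S \<subseteq> T \<Longrightarrow> outer_content S \<le> outer_content T"
  by (rule outer_content_greatest, rule outer_content_lower) auto

lemma outer_content_open: "openin X U \<Longrightarrow> outer_content U = open_content U"
  by (intro antisym outer_content_greatest outer_content_lower open_content_mono) auto

text \<open>The members of \<open>\<A>\<close> that lie inside some \<open>U i\<close> already cover
  \<open>K\<close>. A finite subcover is grouped by a chosen index, and the finite union of each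
  group is again a member, so each index contributes only one set.\<close>

lemma compact_cover:
  assumes K: "compactin X K" and I: "\<And>i. i \<in> I \<Longrightarrow> openin X (U i)" and "K \<subseteq> (\<Union>i\<in>I. U i)"
  obtains J C where "finite J" "J \<subseteq> I" "\<And>i. i \<in> J \<Longrightarrow> C i \<in> \<A> \<and> C i \<subseteq> U i" "K \<subseteq> (\<Union>i\<in>J. C i)"
proof -
  let ?\<U> = "{A\<in>\<A>. \<exists>i\<in>I. A \<subseteq> U i}"
  have "K \<subseteq> \<Union>?\<U>"
  proof
    fix x assume "x \<in> K"
    then obtain i where "i \<in> I" "x \<in> U i" using assms by blast
    then show "x \<in> \<Union>?\<U>" using base[OF I] by blast
  qed
  moreover have "\<forall>V\<in>?\<U>. openin X V" using open_alg by auto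
  ultimately obtain \<F> where \<F>: "finite \<F>" "\<F> \<subseteq> ?\<U>" "K \<subseteq> \<Union>\<F>"
    by (metis (no_types, lifting) compactinD[OF K])
  then have "\<forall>A\<in>\<F>. \<exists>i\<in>I. A \<subseteq> U i" by auto
  then obtain idx where idx: "\<And>A. A \<in> \<F> \<Longrightarrow> idx A \<in> I \<and> A \<subseteq> U (idx A)" by metis
  define C where "C i = \<Union>{A\<in>\<F>. idx A = i}" for i
  have "C i \<in> \<A>" for i
    unfolding C_def using \<F> by (intro alg.finite_Union) auto
  moreover have "C i \<subseteq> U i" for i
    unfolding C_def using idx by auto
  moreover have "K \<subseteq> (\<Union>i\<in>idx ` \<F>. C i)"
    using \<F>(3) unfolding C_def by blast
  moreover have "idx ` \<F> \<subseteq> I" using idx by auto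
  ultimately show thesis
    using \<F>(1) by (intro that[of "idx ` \<F>" C]) auto
qed

text \<open>A member of \<open>\<A>\<close> is closed, hence compact, so finitely many members
  \<open>C i\<close> inside the \<open>U i\<close> cover it. Finite subadditivity of
  \<open>\<nu>\<close> then bounds its value by a finite part of the series.\<close>

lemma open_content_Union_le:
  fixes U :: "nat \<Rightarrow> 'a set"
  assumes U: "\<And>i. openin X (U i)"
  shows "open_content (\<Union>i. U i) \<le> (\<Sum>i. open_content (U i))"
proof (rule open_content_least)
  fix A assume A: "A \<in> \<A>" "A \<subseteq> (\<Union>i. U i)"
  then have "compactin X A"
    using closed_alg closedin_compact_space compact by blast
  then obtain J C where J: "finite J" "J \<subseteq> UNIV" "\<And>i. i \<in> J \<Longrightarrow> C i \<in> \<A> \<and> C i \<subseteq> U i"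
    "A \<subseteq> (\<Union>i\<in>J. C i)"
    by (rule compact_cover[OF _ U A(2)]) (rule that)
  have CJ: "C ` J \<subseteq> \<A>" using J(3) by auto
  have "\<nu> A \<le> \<nu> (\<Union>i\<in>J. C i)"
    using A J CJ by (intro mono alg.finite_Union) auto
  also have "\<dots> \<le> (\<Sum>i\<in>J. \<nu> (C i))"
    by (rule alg.subadditive[OF positive additive CJ J(1)])
  also have "\<dots> \<le> (\<Sum>i\<in>J. open_content (U i))"
    using J by (intro sum_mono open_content_upper) auto
  also have "\<dots> \<le> (\<Sum>i. open_content (U i))"
    using J by (intro sum_le_suminf) auto
  finally show "\<nu> A \<le> (\<Sum>i. open_content (U i))" .
qed

lemma outer_content_finite: "S \<subseteq> topspace X \<Longrightarrow> outer_content S < \<infinity>"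
  using outer_content_lower[OF openin_topspace, of S] open_content_eq[OF alg.top] finite
  by (simp add: top.not_eq_extremum le_less_trans)

lemma outer_content_approx:
  assumes "S \<subseteq> topspace X" "0 < e"
  obtains U where "openin X U" "S \<subseteq> U" "open_content U \<le> outer_content S + e"
proof -
  \<comment> \<open>Strict because the outer content of a subset of the space is finite.\<close>
  have "outer_content S < outer_content S + e"
    using assms outer_content_finite[OF assms(1)] by (auto simp: less_top)
  then obtain U where "openin X U" "S \<subseteq> U" "open_content U < outer_content S + e"
    unfolding outer_content_def INF_less_iff by blast
  then show thesis using that by (meson less_imp_le)
qed

lemma outer_measure_space_outer_content: "outer_measure_space (Pow (topspace X)) outer_content"
  unfolding outer_measure_space_def
proof (intro conjI)
  have "outer_content {} = 0"
    using outer_content_open[of "{}"] open_content_eq[of "{}"] positive by (simp add: positive_def)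
  then show "positive (Pow (topspace X)) outer_content" by (simp add: positive_def)
  show "increasing (Pow (topspace X)) outer_content" by (simp add: increasing_def outer_content_mono)
  show "countably_subadditive (Pow (topspace X)) outer_content"
    unfolding countably_subadditive_def
  proof safe
    fix A :: "nat \<Rightarrow> 'a set" assume A: "range A \<subseteq> Pow (topspace X)"
    show "outer_content (\<Union>i. A i) \<le> (\<Sum>i. outer_content (A i))"
    proof (rule ennreal_le_epsilon)
      fix e :: real assume "0 < e"
      have "\<exists>V. openin X V \<and> A i \<subseteq> V \<and> open_content V \<le> outer_content (A i) + ennreal (e * (1/2)^Suc i)" for i :: nat
      proof -
        have "A i \<subseteq> topspace X" "0 < ennreal (e * (1/2)^Suc i)" using A \<open>0 < e\<close> by auto
        then show ?thesis by (rule outer_content_approx) blast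
      qed
      then obtain V where V: "\<And>i. openin X (V i)" "\<And>i. A i \<subseteq> V i"
        "\<And>i. open_content (V i) \<le> outer_content (A i) + ennreal (e * (1/2)^Suc i)" by metis
      have "outer_content (\<Union>i. A i) \<le> open_content (\<Union>i. V i)"
        using V by (intro outer_content_lower) auto
      also have "\<dots> \<le> (\<Sum>i. open_content (V i))"
        using V by (intro open_content_Union_le) auto
      also have "\<dots> \<le> (\<Sum>i. outer_content (A i) + ennreal (e * (1/2)^Suc i))"
        using V by (intro suminf_le) auto
      also have "\<dots> = (\<Sum>i. outer_content (A i)) + (\<Sum>i. ennreal (e * (1/2)^Suc i))"
        by (subst suminf_add) auto
      also have "(\<Sum>i. ennreal (e * (1/2)^Suc i)) = ennreal e"
        using sums_mult[OF power_half_series, of e] \<open>0 < e\<close>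
        by (intro sums_unique[symmetric]) (auto simp: sums_ennreal)
      finally show "outer_content (\<Union>i. A i) \<le> (\<Sum>i. outer_content (A i)) + ennreal e" .
    qed
  qed
qed

text \<open>The nontrivial half of Caratheodory's criterion for \<open>U\<close>, tested on an open
  \<open>V\<close>. For a member \<open>A\<close> inside \<open>V \<inter> U\<close>, the open set
  \<open>V - A\<close> contains \<open>V - U\<close>, and every member \<open>B\<close> inside
  \<open>V - A\<close> is disjoint from \<open>A\<close>, so that \<open>A \<union> B\<close> is a
  member inside \<open>V\<close>.\<close>

lemma open_content_Int_Diff:
  assumes U: "openin X U" and V: "openin X V"
  shows "open_content (V \<inter> U) + outer_content (V - U) \<le> open_content V"
proof -
  have "\<nu> A + outer_content (V - U) \<le> open_content V" if A: "A \<in> \<A>" "A \<subseteq> V \<inter> U" for A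
  proof -
    have op: "openin X (V - A)" using A V closed_alg by blast
    have "\<nu> A + outer_content (V - U) \<le> \<nu> A + open_content (V - A)"
      using op A by (intro add_left_mono outer_content_lower) auto
    also have "\<dots> = (SUP B\<in>{B\<in>\<A>. B \<subseteq> V - A}. \<nu> A + \<nu> B)"
      unfolding open_content_def by (subst ennreal_SUP_add_right) auto
    also have "\<dots> \<le> open_content V"
    proof (rule SUP_least, clarsimp)
      fix B assume B: "B \<in> \<A>" "B \<subseteq> V - A"
      then have "\<nu> A + \<nu> B = \<nu> (A \<union> B)"
        using A by (intro additiveD[OF additive, symmetric]) auto
      also have "\<dots> \<le> open_content V" using A B by (intro open_content_upper) auto
      finally show "\<nu> A + \<nu> B \<le> open_content V" .
    qed
    finally show ?thesis .
  qed
  moreover have "open_content (V \<inter> U) + outer_content (V - U) = (SUP A\<in>{A\<in>\<A>. A \<subseteq> V \<inter> U}. \<nu> A + outer_content (V - U))"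
    unfolding open_content_def by (subst ennreal_SUP_add_left) auto
  ultimately show ?thesis by (auto intro!: SUP_least)
qed

text \<open>A test set \<open>S\<close> is replaced by the open sets containing it, for which
  \<open>open_content_Int_Diff\<close> gives the criterion. The other inequality is
  subadditivity.\<close>

lemma open_in_lambda_system:
  assumes U: "openin X U"
  shows "U \<in> lambda_system (topspace X) (Pow (topspace X)) outer_content"
proof -
  interpret P: algebra "topspace X" "Pow (topspace X)" by (rule algebra_Pow)
  have sub: "subadditive (Pow (topspace X)) outer_content"
    using outer_measure_space_outer_content P.countably_subadditive_subadditive
    unfolding outer_measure_space_def by blast
  have "outer_content (S \<inter> U) + outer_content (S - U) = outer_content S" if S: "S \<subseteq> topspace X" for S
  proof (rule antisym)
    show "outer_content (S \<inter> U) + outer_content (S - U) \<le> outer_content S"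
    proof (rule outer_content_greatest)
      fix V assume V: "openin X V" "S \<subseteq> V"
      have "outer_content (S \<inter> U) + outer_content (S - U) \<le> open_content (V \<inter> U) + outer_content (V - U)"
        using U V by (intro add_mono outer_content_lower outer_content_mono) auto
      also have "\<dots> \<le> open_content V" using open_content_Int_Diff U V by auto
      finally show "outer_content (S \<inter> U) + outer_content (S - U) \<le> open_content V" .
    qed
    show "outer_content S \<le> outer_content (S \<inter> U) + outer_content (S - U)"
      using subadditiveD[OF sub, of "S \<inter> U" "S - U"] S by (auto simp: Int_Diff_Un)
  qed
  then show ?thesis
    using openin_subset[OF U] by (auto simp: P.lambda_system_eq)
qed

section \<open>The inner regular Borel extension and its uniqueness\<close>

definition extension :: "'a measure" where
  "extension = measure_of (topspace X) {U. openin X U} outer_content"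

lemma
  shows space_extension: "space extension = topspace X"
    and sets_extension: "sets extension = sigma_sets (topspace X) {U. openin X U}"
  using openin_subset by (auto simp: extension_def intro!: space_measure_of sets_measure_of)

text \<open>By Caratheodory the outer content is a measure on its lambda system, which contains the
  open sets and hence all Borel sets. This is what entitles \<open>measure_of\<close> to the
  prescribed values.\<close>

lemma emeasure_extension:
  assumes "A \<in> sets extension"
  shows "emeasure extension A = outer_content A"
proof -
  interpret P: sigma_algebra "topspace X" "Pow (topspace X)" by (rule sigma_algebra_Pow)
  let ?L = "lambda_system (topspace X) (Pow (topspace X)) outer_content"
  have L: "measure_space (topspace X) ?L outer_content"
    using P.caratheodory_lemma outer_measure_space_outer_content by blast
  have sub: "{U. openin X U} \<subseteq> Pow (topspace X)" using openin_subset by auto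
  have "sigma_sets (topspace X) {U. openin X U} \<subseteq> ?L"
    using L open_in_lambda_system unfolding measure_space_def
    by (intro sigma_algebra.sigma_sets_subset) auto
  then have "measure_space (topspace X) (sigma_sets (topspace X) {U. openin X U}) outer_content"
    using L sub by (intro measure_down[OF L] sigma_algebra_sigma_sets) auto
  then show ?thesis
    using assms sub unfolding extension_def
    by (intro emeasure_measure_of) (auto simp: measure_space_def)
qed

lemma open_extension: "openin X U \<Longrightarrow> U \<in> sets extension"
  by (auto simp: sets_extension)

lemma emeasure_extension_alg: "A \<in> \<A> \<Longrightarrow> emeasure extension A = \<nu> A"
  by (simp add: emeasure_extension open_extension open_alg outer_content_open open_content_eq)

text \<open>Outer regularity is built into \<open>outer_content\<close>; in a compact space, taking
  complements turns it into inner regularity. If an open \<open>U\<close> approximates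
  \<open>topspace X - A\<close> from outside, then \<open>topspace X - U\<close> is closed, hence
  compact, and approximates \<open>A\<close> from inside.\<close>

lemma inner_regular_extension: "inner_regular X extension"
  unfolding inner_regular_def
proof safe
  fix A assume A: "A \<in> sets extension"
  let ?\<mu> = "emeasure extension"
  show "?\<mu> A = (SUP K\<in>{K. compactin X K \<and> K \<subseteq> A}. ?\<mu> K)"
  proof (rule antisym)
    show "(SUP K\<in>{K. compactin X K \<and> K \<subseteq> A}. ?\<mu> K) \<le> ?\<mu> A"
      using A by (intro SUP_least emeasure_mono) auto
    have top: "?\<mu> (topspace X) \<noteq> \<infinity>"
      using finite emeasure_extension_alg[OF alg.top] by simp
    interpret finite_measure extension
      using top by (intro finite_measureI) (simp add: space_extension)
    show "?\<mu> A \<le> (SUP K\<in>{K. compactin X K \<and> K \<subseteq> A}. ?\<mu> K)"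
    proof (rule ennreal_le_epsilon)
      fix e :: real assume "0 < e"
      have Asub: "A \<subseteq> topspace X" using sets.sets_into_space[OF A] by (simp add: space_extension)
      obtain U where U: "openin X U" "topspace X - A \<subseteq> U"
        "open_content U \<le> outer_content (topspace X - A) + ennreal e"
        using outer_content_approx[of "topspace X - A" "ennreal e"] \<open>0 < e\<close> by auto
      have Ac: "topspace X - A \<in> sets extension"
        using sets.compl_sets[OF A] by (simp add: space_extension)
      have Um: "U \<in> sets extension" using U open_extension by auto
      let ?K = "topspace X - U"
      have Km: "?K \<in> sets extension"
        using sets.compl_sets[OF Um] by (simp add: space_extension)
      have K: "compactin X ?K" "?K \<subseteq> A"
        using U compact by (auto intro!: closedin_compact_space)
      have "?\<mu> (A - ?K) = ?\<mu> (U - (topspace X - A))"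
        using Asub openin_subset[OF U(1)] by (intro arg_cong[where f="?\<mu>"]) auto
      also have "\<dots> = ?\<mu> U - ?\<mu> (topspace X - A)"
        using Um Ac U(2) by (intro emeasure_Diff) auto
      also have "\<dots> \<le> ennreal e"
        using U(3) outer_content_finite[of "topspace X - A"]
        by (auto simp: emeasure_extension[OF Um] emeasure_extension[OF Ac] outer_content_open[OF U(1)]
            ennreal_minus_le_iff)
      finally have *: "?\<mu> (A - ?K) \<le> ennreal e" .
      have "?\<mu> A = ?\<mu> ?K + ?\<mu> (A - ?K)"
        using A Km K(2) plus_emeasure[of ?K extension "A - ?K"]
        by (metis Diff_disjoint Diff_partition sets.Diff)
      also have "\<dots> \<le> (SUP K\<in>{K. compactin X K \<and> K \<subseteq> A}. ?\<mu> K) + ennreal e"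
        using K * by (intro add_mono SUP_upper) auto
      finally show "?\<mu> A \<le> (SUP K\<in>{K. compactin X K \<and> K \<subseteq> A}. ?\<mu> K) + ennreal e" .
    qed
  qed
qed

text \<open>Between a compact set and an open set containing it there is a member of
  \<open>\<A>\<close>, so the supremum over compact subsets is also the supremum over
  members.\<close>

lemma inner_regular_open:
  assumes M: "inner_regular X M" "sets M = sigma_sets (topspace X) {U. openin X U}"
    and eq: "\<And>A. A \<in> \<A> \<Longrightarrow> emeasure M A = \<nu> A" and U: "openin X U"
  shows "emeasure M U = open_content U"
proof (rule antisym)
  have Um: "V \<in> sets M" if "openin X V" for V using that M by auto
  show "emeasure M U \<le> open_content U"
  proof -
    have "emeasure M K \<le> open_content U" if K: "compactin X K" "K \<subseteq> U" for K
    proof -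
      \<comment> \<open>The one-element index set specialises \<open>compact_cover\<close> to a
        single open set.\<close>
      obtain J :: "unit set" and C where J: "finite J" "\<And>i. i \<in> J \<Longrightarrow> C i \<in> \<A> \<and> C i \<subseteq> U" "K \<subseteq> (\<Union>i\<in>J. C i)"
      proof (rule compact_cover[OF K(1), of "{()}" "\<lambda>_. U"])
        fix J :: "unit set" and C
        assume "finite J" "\<And>i. i \<in> J \<Longrightarrow> C i \<in> \<A> \<and> C i \<subseteq> U" "K \<subseteq> (\<Union>i\<in>J. C i)"
        then show thesis by (rule that)
      qed (use K U in simp_all)
      have C: "(\<Union>i\<in>J. C i) \<in> \<A>" using J by (intro alg.finite_Union) auto
      have "emeasure M K \<le> emeasure M (\<Union>i\<in>J. C i)"
        using J(3) C open_alg Um by (intro emeasure_mono) auto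
      also have "\<dots> = \<nu> (\<Union>i\<in>J. C i)" using eq[OF C] .
      also have "\<dots> \<le> open_content U" using C J by (intro open_content_upper) auto
      finally show ?thesis .
    qed
    moreover have "emeasure M U = (SUP K\<in>{K. compactin X K \<and> K \<subseteq> U}. emeasure M K)"
      using M(1) Um[OF U] unfolding inner_regular_def by blast
    ultimately show ?thesis by (simp only:) (intro SUP_least, blast)
  qed
  show "open_content U \<le> emeasure M U"
    using Um[OF U] by (intro open_content_least) (auto intro!: emeasure_mono simp flip: eq)
qed

text \<open>The open sets are an intersection-stable generator of the Borel sets and the total mass
  is finite, so the values found in \<open>inner_regular_open\<close> determine the measure.\<close>

lemma extension_unique:
  assumes M: "inner_regular X M" "sets M = sigma_sets (topspace X) {U. openin X U}"
    and eq: "\<And>A. A \<in> \<A> \<Longrightarrow> emeasure M A = \<nu> A"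
  shows "M = extension"
proof (rule measure_eqI_generator_eq[OF _ _ _ M(2) sets_extension])
  show "Int_stable {U. openin X U}" by (auto simp: Int_stable_def)
  show "{U. openin X U} \<subseteq> Pow (topspace X)" using openin_subset by auto
  show "emeasure M U = emeasure extension U" if "U \<in> {U. openin X U}" for U
    using that inner_regular_open[OF M eq, of U] emeasure_extension[OF open_extension, of U] outer_content_open[of U]
    by simp
  show "range (\<lambda>_::nat. topspace X) \<subseteq> {U. openin X U}" by auto
  show "(\<Union>i::nat. topspace X) = topspace X" by simp
  show "emeasure M (topspace X) \<noteq> \<infinity>" for i :: nat
    using eq[OF alg.top] finite by simp
qed

end

section \<open>Stone duality for algebras of regular open sets\<close>

locale regular_open_algebra =
  fixes X :: "'a topology" and \<BB> :: "'a set set"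
  assumes subalgebra: "boolean_subalgebra X \<BB>"
begin

lemma regular: "R \<in> \<BB> \<Longrightarrow> R \<in> regular_opens X"
  using subalgebra by (auto simp: boolean_subalgebra_def)

lemma openin: "R \<in> \<BB> \<Longrightarrow> openin X R"
  using regular by (auto simp: regular_opens_def)

lemma subset_topspace: "R \<in> \<BB> \<Longrightarrow> R \<subseteq> topspace X"
  using openin openin_subset by blast

lemma Int_mem: "Q \<in> \<BB> \<Longrightarrow> R \<in> \<BB> \<Longrightarrow> Q \<inter> R \<in> \<BB>"
  using subalgebra by (auto simp: boolean_subalgebra_def)

lemma join_mem: "Q \<in> \<BB> \<Longrightarrow> R \<in> \<BB> \<Longrightarrow> ro_join X Q R \<in> \<BB>"
  using subalgebra by (auto simp: boolean_subalgebra_def)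

lemma compl_mem: "R \<in> \<BB> \<Longrightarrow> ro_compl X R \<in> \<BB>"
  using subalgebra by (auto simp: boolean_subalgebra_def)

lemma compl_disjoint: "R \<inter> ro_compl X R = {}"
  using interior_of_subset[of X "topspace X - R"] by (auto simp: ro_compl_def)

lemma subset_compl: "R \<in> \<BB> \<Longrightarrow> R \<inter> S = {} \<Longrightarrow> R \<subseteq> ro_compl X S"
  unfolding ro_compl_def using openin subset_topspace by (intro interior_of_maximal) auto

text \<open>\<open>ro_compl X R\<close> is the complement of the closure of \<open>R\<close>, so the
  closures of \<open>R\<close> and of \<open>ro_compl X R\<close> cover the space.\<close>

lemma join_compl: "R \<in> \<BB> \<Longrightarrow> ro_join X R (ro_compl X R) = topspace X"
proof -
  assume R: "R \<in> \<BB>"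
  have "topspace X \<subseteq> X closure_of R \<union> X closure_of (ro_compl X R)"
    using closure_of_subset[of "ro_compl X R" X] R
    by (auto simp: ro_compl_def interior_of_complement interior_of_subset_topspace)
  then have "X closure_of (R \<union> ro_compl X R) = topspace X"
    using closure_of_subset_topspace[of X] by (simp add: subset_antisym)
  then show ?thesis by (simp add: ro_join_def)
qed

lemma empty_mem: "{} \<in> \<BB>"
  using subalgebra Int_mem compl_mem compl_disjoint by (metis boolean_subalgebra_def ex_in_conv)

lemma topspace_mem: "topspace X \<in> \<BB>"
  using join_compl[OF empty_mem] join_mem compl_mem empty_mem by metis

lemma subset_join: "Q \<in> \<BB> \<Longrightarrow> R \<in> \<BB> \<Longrightarrow> Q \<union> R \<subseteq> ro_join X Q R"
  unfolding ro_join_def using openin subset_topspace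
  by (intro interior_of_maximal closure_of_subset) auto

lemma join_empty: "R \<in> \<BB> \<Longrightarrow> ro_join X R {} = R"
  using regular unfolding ro_join_def regular_opens_def by simp

text \<open>An open set that misses \<open>Q \<union> R\<close> also misses its closure, and the
  join lies in that closure. This serves as the distributive law needed for
  \<open>ultrafilter_join_iff\<close>.\<close>

lemma join_Int_compl: "Q \<in> \<BB> \<Longrightarrow> R \<in> \<BB> \<Longrightarrow> ro_join X Q R \<inter> (ro_compl X Q \<inter> ro_compl X R) = {}"
proof -
  assume QR: "Q \<in> \<BB>" "R \<in> \<BB>"
  let ?W = "ro_compl X Q \<inter> ro_compl X R"
  have "openin X ?W" using QR compl_mem Int_mem openin by blast
  moreover have "?W \<inter> (Q \<union> R) = {}" using compl_disjoint by blast
  ultimately have "?W \<inter> X closure_of (Q \<union> R) = {}"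
    by (simp only: openin_Int_closure_of_eq_empty)
  then show ?thesis
    using interior_of_subset[of X "X closure_of (Q \<union> R)"] by (auto simp: ro_join_def)
qed

text \<open>Disjointness from \<open>ro_compl X R\<close> only places \<open>Q\<close> in the
  closure of \<open>R\<close>. Since \<open>Q\<close> is open it lies in the interior of that
  closure, which is \<open>R\<close> by regularity.\<close>

lemma subset_if_disjoint_compl:
  assumes "Q \<in> \<BB>" "R \<in> \<BB>" "Q \<inter> ro_compl X R = {}"
  shows "Q \<subseteq> R"
proof -
  have "Q \<subseteq> X closure_of R"
    using assms(3) subset_topspace[OF assms(1)] by (auto simp: ro_compl_def interior_of_complement)
  then have "Q \<subseteq> X interior_of (X closure_of R)"
    using openin[OF assms(1)] by (rule interior_of_maximal)
  then show ?thesis using regular[OF assms(2)] unfolding regular_opens_def by blast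
qed

section \<open>Filters and ultrafilters of the algebra\<close>

lemma proper_filterD:
  assumes "proper_filter X \<BB> F"
  shows "F \<subseteq> \<BB>" "topspace X \<in> F" "{} \<notin> F" "A \<in> F \<Longrightarrow> B \<in> F \<Longrightarrow> A \<inter> B \<in> F"
    "A \<in> F \<Longrightarrow> B \<in> \<BB> \<Longrightarrow> A \<subseteq> B \<Longrightarrow> B \<in> F"
  using assms by (auto simp: proper_filter_def)

lemma ultrafilterD:
  assumes "s \<in> ultrafilters X \<BB>"
  shows "proper_filter X \<BB> s"
  using assms by (simp add: ultrafilters_def)

text \<open>Zorn's lemma: the union of a chain of proper filters is a proper filter. The chain has
  to be nonempty for its union to contain the whole space.\<close>

lemma proper_filter_extends:
  assumes "proper_filter X \<BB> F"
  obtains s where "s \<in> ultrafilters X \<BB>" "F \<subseteq> s"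
proof -
  let ?\<P> = "{G. proper_filter X \<BB> G \<and> F \<subseteq> G}"
  have "\<exists>M\<in>?\<P>. \<forall>G\<in>?\<P>. M \<subseteq> G \<longrightarrow> G = M"
  proof (rule subset_Zorn_nonempty)
    show "?\<P> \<noteq> {}" using assms by auto
    fix \<C> assume ne: "\<C> \<noteq> {}" and ch: "subset.chain ?\<P> \<C>"
    then have sub: "\<And>G. G \<in> \<C> \<Longrightarrow> proper_filter X \<BB> G \<and> F \<subseteq> G"
      by (auto simp: subset.chain_def)
    have dir: "\<exists>K\<in>\<C>. G \<subseteq> K \<and> H \<subseteq> K" if "G \<in> \<C>" "H \<in> \<C>" for G H
      using ch that by (metis order_refl subset_chain_def)
    have "A \<inter> B \<in> \<Union>\<C>" if "A \<in> \<Union>\<C>" "B \<in> \<Union>\<C>" for A B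
    proof -
      obtain K where "K \<in> \<C>" "A \<in> K" "B \<in> K" using dir \<open>A \<in> \<Union>\<C>\<close> \<open>B \<in> \<Union>\<C>\<close> by blast
      then show ?thesis using proper_filterD(4) sub by blast
    qed
    moreover have "\<Union>\<C> \<subseteq> \<BB>" "{} \<notin> \<Union>\<C>" using sub proper_filterD by blast+
    moreover have "topspace X \<in> \<Union>\<C>" using sub ne proper_filterD(2) by blast
    moreover have "B \<in> \<Union>\<C>" if "A \<in> \<Union>\<C>" "B \<in> \<BB>" "A \<subseteq> B" for A B
      using sub that proper_filterD(5) by blast
    ultimately have "proper_filter X \<BB> (\<Union>\<C>)" unfolding proper_filter_def by blast
    then show "\<Union>\<C> \<in> ?\<P>" using sub ne by blast
  qed
  then obtain s where s: "s \<in> ?\<P>" "\<forall>G\<in>?\<P>. s \<subseteq> G \<longrightarrow> G = s" by (rule bexE)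
  then have "s \<in> ultrafilters X \<BB>" "F \<subseteq> s" by (auto simp: ultrafilters_def)
  then show thesis by (rule that)
qed

text \<open>The finite intersections from \<open>S\<close> generate a filter, which is proper by the
  finite intersection property. The factor \<open>topspace X\<close> accounts for the empty
  \<open>T\<close>, whose intersection is \<open>UNIV\<close>.\<close>

lemma ultrafilter_extends:
  assumes S: "S \<subseteq> \<BB>" and fip: "\<And>T. finite T \<Longrightarrow> T \<subseteq> S \<Longrightarrow> topspace X \<inter> \<Inter>T \<noteq> {}"
  obtains s where "s \<in> ultrafilters X \<BB>" "S \<subseteq> s"
proof -
  let ?F = "{B\<in>\<BB>. \<exists>T. finite T \<and> T \<subseteq> S \<and> topspace X \<inter> \<Inter>T \<subseteq> B}"
  have "A \<inter> B \<in> ?F" if AB: "A \<in> ?F" "B \<in> ?F" for A B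
  proof -
    obtain T U where "finite T" "T \<subseteq> S" "topspace X \<inter> \<Inter>T \<subseteq> A"
      "finite U" "U \<subseteq> S" "topspace X \<inter> \<Inter>U \<subseteq> B" using AB by blast
    then have "finite (T \<union> U)" "T \<union> U \<subseteq> S" "topspace X \<inter> \<Inter>(T \<union> U) \<subseteq> A \<inter> B" by auto
    then show ?thesis using AB Int_mem by blast
  qed
  moreover have "topspace X \<in> ?F" using topspace_mem by blast
  moreover have "{} \<notin> ?F" using fip by blast
  moreover have "?F \<subseteq> \<BB>" by blast
  moreover have "B \<in> ?F" if "A \<in> ?F" "B \<in> \<BB>" "A \<subseteq> B" for A B
    using that by (blast intro: subset_trans)
  ultimately have "proper_filter X \<BB> ?F"
    unfolding proper_filter_def by (intro conjI ballI impI)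
  then obtain s where s: "s \<in> ultrafilters X \<BB>" "?F \<subseteq> s" by (rule proper_filter_extends)
  have "S \<subseteq> ?F"
  proof
    fix R assume "R \<in> S"
    then have "finite {R}" "{R} \<subseteq> S" "topspace X \<inter> \<Inter>{R} \<subseteq> R" "R \<in> \<BB>" using S by auto
    then show "R \<in> ?F" by blast
  qed
  then show thesis using s by (intro that[of s]) auto
qed

text \<open>If some member of \<open>s\<close> misses \<open>B\<close>, it lies below the complement
  of \<open>B\<close>. Otherwise \<open>s\<close> and \<open>B\<close> together generate a proper
  filter, which equals \<open>s\<close> by maximality.\<close>

lemma ultrafilter_mem_or_compl:
  assumes s: "s \<in> ultrafilters X \<BB>" and B: "B \<in> \<BB>"
  shows "B \<in> s \<or> ro_compl X B \<in> s"
proof (cases "\<exists>A\<in>s. A \<inter> B = {}")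
  case True
  then obtain A where A: "A \<in> s" "A \<inter> B = {}" by blast
  then have "A \<subseteq> ro_compl X B"
    using proper_filterD(1)[OF ultrafilterD[OF s]] subset_compl by blast
  then show ?thesis using A proper_filterD(5)[OF ultrafilterD[OF s]] compl_mem B by blast
next
  case False
  note sD = proper_filterD[OF ultrafilterD[OF s]]
  let ?G = "{C\<in>\<BB>. \<exists>A\<in>s. A \<inter> B \<subseteq> C}"
  have "proper_filter X \<BB> ?G"
    unfolding proper_filter_def
  proof (intro conjI ballI impI)
    show "topspace X \<in> ?G" using sD(2) topspace_mem by blast
    fix C assume C: "C \<in> ?G"
    then obtain A where A: "A \<in> s" "A \<inter> B \<subseteq> C" "C \<in> \<BB>" by blast
    show "D \<in> ?G" if "D \<in> \<BB>" "C \<subseteq> D" for D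
      using A that by blast
    show "C \<inter> D \<in> ?G" if D: "D \<in> ?G" for D
    proof -
      obtain E where "E \<in> s" "E \<inter> B \<subseteq> D" "D \<in> \<BB>" using D by blast
      then have "A \<inter> E \<in> s" "(A \<inter> E) \<inter> B \<subseteq> C \<inter> D" "C \<inter> D \<in> \<BB>"
        using A sD(4) Int_mem by auto
      then show ?thesis by blast
    qed
  qed (use False in blast)+
  moreover have "s \<subseteq> ?G" using sD(1) by blast
  ultimately have "?G = s" using s by (auto simp: ultrafilters_def)
  moreover have "B \<in> ?G" using sD(2) B by blast
  ultimately show ?thesis by blast
qed

text \<open>A larger proper filter containing \<open>B\<close> cannot contain
  \<open>ro_compl X B\<close>, so the alternative for \<open>B\<close> already puts \<open>B\<close>
  into \<open>F\<close>.\<close>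

lemma ultrafilterI:
  assumes F: "proper_filter X \<BB> F" and "\<And>B. B \<in> \<BB> \<Longrightarrow> B \<in> F \<or> ro_compl X B \<in> F"
  shows "F \<in> ultrafilters X \<BB>"
proof -
  have "G = F" if G: "proper_filter X \<BB> G" "F \<subseteq> G" for G
  proof (rule antisym, rule subsetI)
    fix B assume B: "B \<in> G"
    then have "ro_compl X B \<notin> F"
      using proper_filterD(3,4)[OF G(1)] G(2) compl_disjoint[of B] by (metis subsetD)
    then show "B \<in> F" using assms(2) B proper_filterD(1)[OF G(1)] by blast
  qed (rule G(2))
  then show ?thesis using F by (simp add: ultrafilters_def)
qed

lemma ultrafilter_compl_iff:
  assumes s: "s \<in> ultrafilters X \<BB>" and B: "B \<in> \<BB>"
  shows "ro_compl X B \<in> s \<longleftrightarrow> B \<notin> s"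
  using ultrafilter_mem_or_compl[OF s B] proper_filterD(3,4)[OF ultrafilterD[OF s]] compl_disjoint[of B]
  by metis

lemma ultrafilter_Int_iff:
  assumes s: "s \<in> ultrafilters X \<BB>" and B: "A \<in> \<BB>" "B \<in> \<BB>"
  shows "A \<inter> B \<in> s \<longleftrightarrow> A \<in> s \<and> B \<in> s"
  using proper_filterD(4,5)[OF ultrafilterD[OF s]] B by blast

text \<open>If the join belonged to \<open>s\<close> but neither of \<open>A\<close> and
  \<open>B\<close> did, both complements would, and by \<open>join_Int_compl\<close> the empty set
  would be in \<open>s\<close>.\<close>

lemma ultrafilter_join_iff:
  assumes s: "s \<in> ultrafilters X \<BB>" and B: "A \<in> \<BB>" "B \<in> \<BB>"
  shows "ro_join X A B \<in> s \<longleftrightarrow> A \<in> s \<or> B \<in> s"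
proof
  show "ro_join X A B \<in> s" if "A \<in> s \<or> B \<in> s"
    using that subset_join[OF B] join_mem[OF B] proper_filterD(5)[OF ultrafilterD[OF s]] by blast
  show "A \<in> s \<or> B \<in> s" if "ro_join X A B \<in> s"
  proof (rule ccontr)
    assume "\<not> (A \<in> s \<or> B \<in> s)"
    then have "ro_join X A B \<inter> (ro_compl X A \<inter> ro_compl X B) \<in> s"
      using that s B ultrafilter_compl_iff proper_filterD(4)[OF ultrafilterD[OF s]] by blast
    then show False
      using join_Int_compl[OF B] proper_filterD(3)[OF ultrafilterD[OF s]] by simp
  qed
qed

text \<open>If \<open>Q\<close> is not contained in \<open>R\<close>, the nonempty element
  \<open>Q \<inter> ro_compl X R\<close> lies in some ultrafilter, and that ultrafilter contains
  \<open>Q\<close> but not \<open>R\<close>.\<close>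

lemma ultrafilters_separate:
  assumes "A \<in> \<BB>" "B \<in> \<BB>" and eq: "\<And>s. s \<in> ultrafilters X \<BB> \<Longrightarrow> A \<in> s \<longleftrightarrow> B \<in> s"
  shows "A = B"
proof -
  have "Q \<subseteq> R" if Q: "Q \<in> \<BB>" and R: "R \<in> \<BB>" and QR: "\<And>s. s \<in> ultrafilters X \<BB> \<Longrightarrow> Q \<in> s \<longleftrightarrow> R \<in> s" for Q R
  proof (rule ccontr)
    assume "\<not> Q \<subseteq> R"
    then have ne: "Q \<inter> ro_compl X R \<noteq> {}" using subset_if_disjoint_compl[OF Q R] by blast
    have mem: "Q \<inter> ro_compl X R \<in> \<BB>" using Q R by (intro Int_mem compl_mem)
    obtain s where s: "s \<in> ultrafilters X \<BB>" "{Q \<inter> ro_compl X R} \<subseteq> s"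
    proof (rule ultrafilter_extends[of "{Q \<inter> ro_compl X R}"])
      fix T assume "T \<subseteq> {Q \<inter> ro_compl X R}"
      then have "Q \<inter> ro_compl X R \<subseteq> topspace X \<inter> \<Inter>T" using mem subset_topspace by blast
      then show "topspace X \<inter> \<Inter>T \<noteq> {}" using ne by blast
    qed (use mem in auto)
    then show False
      using QR[OF s(1)] ultrafilter_Int_iff[OF s(1) Q compl_mem[OF R]] ultrafilter_compl_iff[OF s(1) R]
      by simp
  qed
  then show ?thesis using assms by (intro subset_antisym) simp_all
qed

end

section \<open>The Stone space: its clopen base, compactness and separation\<close>

locale stone_dual = regular_open_algebra "pts C" "alg C" for C :: "'a content_triple"
begin

lemma star_set_Int: "A \<in> alg C \<Longrightarrow> B \<in> alg C \<Longrightarrow> star_set C (A \<inter> B) = star_set C A \<inter> star_set C B"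
  using ultrafilter_Int_iff by (auto simp: star_set_def)

lemma star_set_join:
  "A \<in> alg C \<Longrightarrow> B \<in> alg C \<Longrightarrow> star_set C (ro_join (pts C) A B) = star_set C A \<union> star_set C B"
  using ultrafilter_join_iff by (auto simp: star_set_def)

lemma star_set_compl:
  "B \<in> alg C \<Longrightarrow> star_set C (ro_compl (pts C) B) = ultrafilters (pts C) (alg C) - star_set C B"
  using ultrafilter_compl_iff by (auto simp: star_set_def)

lemma star_set_empty: "star_set C {} = {}"
  using ultrafilterD proper_filterD(3) by (auto simp: star_set_def)

lemma star_set_topspace: "star_set C (topspace (pts C)) = ultrafilters (pts C) (alg C)"
  using ultrafilterD proper_filterD(2) by (auto simp: star_set_def)

lemma inj_star_set: "inj_on (star_set C) (alg C)"
  using ultrafilters_separate unfolding inj_on_def star_set_def by blast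

lemma topspace_stone_space [simp]: "topspace (stone_space C) = ultrafilters (pts C) (alg C)"
  using star_set_topspace topspace_mem
  by (auto simp: stone_space_def star_set_def)

lemma algebra_star_sets: "algebra (topspace (stone_space C)) (star_set C ` alg C)"
  unfolding algebra_iff_Un
proof (intro conjI ballI)
  show "star_set C ` alg C \<subseteq> Pow (topspace (stone_space C))"
    by (auto simp: star_set_def)
  show "{} \<in> star_set C ` alg C" using star_set_empty empty_mem by force
  show "topspace (stone_space C) - S \<in> star_set C ` alg C" if "S \<in> star_set C ` alg C" for S
    using that compl_mem by (auto simp flip: star_set_compl)
  show "S \<union> T \<in> star_set C ` alg C" if "S \<in> star_set C ` alg C" "T \<in> star_set C ` alg C" for S T
    using that join_mem by (auto simp flip: star_set_join)
qed

lemma openin_star_set: "B \<in> alg C \<Longrightarrow> openin (stone_space C) (star_set C B)"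
  by (simp add: stone_space_def topology_generated_by_Basis)

lemma closedin_star_set: "B \<in> alg C \<Longrightarrow> closedin (stone_space C) (star_set C B)"
  using openin_star_set[OF compl_mem, of B] star_set_compl[of B]
  by (simp add: closedin_def) (auto simp: star_set_def)

lemma star_set_base:
  assumes "openin (stone_space C) U" "s \<in> U"
  shows "\<exists>B\<in>alg C. s \<in> star_set C B \<and> star_set C B \<subseteq> U"
proof -
  have "generate_topology_on (star_set C ` alg C) U"
    using assms(1) by (simp add: stone_space_def openin_topology_generated_by)
  then show ?thesis using assms(2)
  proof (induction arbitrary: s)
    case (Int U V)
    then obtain A B where "A \<in> alg C" "s \<in> star_set C A" "star_set C A \<subseteq> U"
      "B \<in> alg C" "s \<in> star_set C B" "star_set C B \<subseteq> V" by (meson IntD1 IntD2)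
    then show ?case using star_set_Int Int_mem by (intro bexI[of _ "A \<inter> B"]) auto
  next
    case (UN K)
    then show ?case by (meson UnionE Union_upper subset_trans)
  qed auto
qed

lemma separating_star_set:
  assumes "s \<in> ultrafilters (pts C) (alg C)" "t \<in> ultrafilters (pts C) (alg C)" "s \<noteq> t"
  obtains B where "B \<in> alg C" "s \<in> star_set C B" "t \<notin> star_set C B"
proof -
  \<comment> \<open>Ultrafilters are maximal, so distinct ones are incomparable.\<close>
  have "\<not> s \<subseteq> t" using assms unfolding ultrafilters_def by blast
  then obtain B where "B \<in> s" "B \<notin> t" by blast
  then show thesis
    using that assms proper_filterD(1)[OF ultrafilterD[OF assms(1)]] by (auto simp: star_set_def)
qed

lemma Hausdorff_stone_space: "Hausdorff_space (stone_space C)"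
  unfolding Hausdorff_space_def
proof (intro allI impI)
  fix s t assume "s \<in> topspace (stone_space C) \<and> t \<in> topspace (stone_space C) \<and> s \<noteq> t"
  then have st: "s \<in> ultrafilters (pts C) (alg C)" "t \<in> ultrafilters (pts C) (alg C)" "s \<noteq> t" by auto
  then obtain B where B: "B \<in> alg C" "s \<in> star_set C B" "t \<notin> star_set C B"
    by (rule separating_star_set)
  have "t \<in> star_set C (ro_compl (pts C) B)" "disjnt (star_set C B) (star_set C (ro_compl (pts C) B))"
    using B(3) st(2) by (auto simp: star_set_compl[OF B(1)] disjnt_def)
  then show "\<exists>U V. openin (stone_space C) U \<and> openin (stone_space C) V \<and> s \<in> U \<and> t \<in> V \<and> disjnt U V"
    using openin_star_set[OF B(1)] openin_star_set[OF compl_mem[OF B(1)]] B(2) by blast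
qed

text \<open>Let \<open>?V\<close> collect the elements whose star sets lie inside some set of the
  cover. If no finite subcover exists, the complements of these elements have the finite
  intersection property. An ultrafilter containing all the complements then lies in no star set of
  an element of \<open>?V\<close>, although those star sets cover the space.\<close>

lemma compact_stone_space: "compact_space (stone_space C)"
  unfolding compact_space_alt
proof (intro allI impI, rule ccontr)
  fix \<U> assume \<U>: "(\<forall>U\<in>\<U>. openin (stone_space C) U) \<and> topspace (stone_space C) \<subseteq> \<Union>\<U>"
    and no: "\<not> (\<exists>\<F>. finite \<F> \<and> \<F> \<subseteq> \<U> \<and> topspace (stone_space C) \<subseteq> \<Union>\<F>)"
  let ?V = "{B\<in>alg C. \<exists>U\<in>\<U>. star_set C B \<subseteq> U}"
  have "topspace (pts C) \<inter> \<Inter>T \<noteq> {}" if T: "finite T" "T \<subseteq> ro_compl (pts C) ` ?V" for T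
  proof
    assume empty: "topspace (pts C) \<inter> \<Inter>T = {}"
    obtain W where W: "finite W" "W \<subseteq> ?V" "T = ro_compl (pts C) ` W"
      using finite_subset_image[OF T] by blast
    have "\<forall>B\<in>W. \<exists>U\<in>\<U>. star_set C B \<subseteq> U" using W(2) by auto
    then obtain u where u: "\<And>B. B \<in> W \<Longrightarrow> u B \<in> \<U> \<and> star_set C B \<subseteq> u B"
      by metis
    \<comment> \<open>Otherwise \<open>s\<close> contains every complement in \<open>T\<close>,
      hence their intersection, which is empty. It follows that the sets \<open>u B\<close> form a
      finite subcover.\<close>
    have "\<exists>B\<in>W. s \<in> star_set C B" if s: "s \<in> ultrafilters (pts C) (alg C)" for s
    proof (rule ccontr)
      note sD = proper_filterD[OF ultrafilterD[OF s]]
      assume "\<not> ?thesis"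
      then have "ro_compl (pts C) B \<in> s" if "B \<in> W" for B
        using that W(2) s ultrafilter_compl_iff[OF s] by (auto simp: star_set_def)
      then have "T \<subseteq> s" using W(3) by blast
      with \<open>finite T\<close> have "topspace (pts C) \<inter> \<Inter>T \<in> s"
      proof induction
        case (insert R T)
        then show ?case using sD(4)[of R "topspace (pts C) \<inter> \<Inter>T"] by (simp add: Int_left_commute)
      qed (use sD(2) in simp)
      then show False using empty sD(3) by simp
    qed
    then have "topspace (stone_space C) \<subseteq> \<Union>(u ` W)" using u by fastforce
    moreover have "finite (u ` W)" "u ` W \<subseteq> \<U>" using W u by auto
    ultimately show False using no by blast
  qed
  moreover have "ro_compl (pts C) ` ?V \<subseteq> alg C" using compl_mem by auto
  ultimately obtain s where s: "s \<in> ultrafilters (pts C) (alg C)" "ro_compl (pts C) ` ?V \<subseteq> s"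
    by (metis (no_types, lifting) ultrafilter_extends)
  then obtain U where U: "U \<in> \<U>" "s \<in> U" using \<U> by auto
  then obtain B where B: "B \<in> alg C" "s \<in> star_set C B" "star_set C B \<subseteq> U"
    using star_set_base[of U s] \<U> by auto
  then have "ro_compl (pts C) B \<in> s" using s(2) U(1) by blast
  then show False using B(1,2) ultrafilter_compl_iff[OF s(1)] by (auto simp: star_set_def)
qed

lemma stonean_stone_space: "stonean_space (stone_space C)"
  unfolding stonean_space_def
proof (intro conjI allI impI compact_stone_space Hausdorff_stone_space)
  fix S assume S: "connectedin (stone_space C) S"
  have "s = t" if "s \<in> S" "t \<in> S" for s t
  proof (rule ccontr)
    assume "s \<noteq> t"
    moreover have "s \<in> ultrafilters (pts C) (alg C)" "t \<in> ultrafilters (pts C) (alg C)"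
      using connectedin_subset_topspace[OF S] that by auto
    ultimately obtain B where B: "B \<in> alg C" "s \<in> star_set C B" "t \<notin> star_set C B"
      by (metis separating_star_set)
    then show False
      using connectedin_clopen_cases[OF S closedin_star_set openin_star_set] that
      by (meson disjnt_iff subsetD)
  qed
  then show "\<exists>a. S \<subseteq> {a}" by blast
qed

end

section \<open>Traces on the Stone-Cech compactification\<close>

lemma mem_regular_opens_interior_closure:
  "X interior_of (X closure_of S) \<in> regular_opens X"
  by (simp add: regular_opens_def)
     (intro antisym interior_of_mono closure_of_minimal interior_of_subset interior_of_maximal
      closure_of_subset interior_of_subset_topspace, auto)

lemma dense_embedding_regular_open_extension:
  assumes e: "embedding_map X Y e" and dense: "Y closure_of (e ` topspace X) = topspace Y"
    and R: "R \<in> regular_opens X"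
  shows "\<exists>!Q. Q \<in> regular_opens Y \<and> e -` Q \<inter> topspace X = R"
proof -
  let ?D = "e ` topspace X"
  let ?Q = "Y interior_of (Y closure_of (e ` R))"
  have oR: "openin X R" and rR: "X interior_of (X closure_of R) = R"
    using R by (auto simp: regular_opens_def)
  have RX: "R \<subseteq> topspace X" using oR openin_subset by blast
  have h: "homeomorphic_map X (subtopology Y ?D) e" using e by (simp add: embedding_map_def)
  then have inj: "inj_on e (topspace X)" by (rule homeomorphic_imp_injective_map)
  have cont: "continuous_map X Y e"
    using homeomorphic_imp_continuous_map[OF h] by (rule continuous_map_into_fulltopology)
  have cl: "e ` (X closure_of R) = ?D \<inter> Y closure_of (e ` R)"
    using homeomorphic_map_closure_of[OF h RX] RX
    by (simp add: closure_of_subtopology Int_absorb1 image_mono)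
  have closure: "Y closure_of (U \<inter> ?D) = Y closure_of U" if "openin Y U" for U
    using that dense openin_subset[OF that] by (intro closure_of_openin_Int_superset) auto
  have "openin (subtopology Y ?D) (e ` R)"
    using homeomorphic_map_openness[OF h RX] oR by simp
  then obtain U where U: "openin Y U" "e ` R = U \<inter> ?D"
    by (auto simp: openin_subtopology)
  have trace: "e -` ?Q \<inter> topspace X = R"
  proof
    show "e -` ?Q \<inter> topspace X \<subseteq> R"
    proof -
      have "openin X {x \<in> topspace X. e x \<in> ?Q}"
        using cont by (rule openin_continuous_map_preimage) simp
      moreover have "{x \<in> topspace X. e x \<in> ?Q} \<subseteq> X closure_of R"
      proof
        fix x assume x: "x \<in> {x \<in> topspace X. e x \<in> ?Q}"
        then have "e x \<in> e ` (X closure_of R)"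
          using interior_of_subset[of Y "Y closure_of (e ` R)"] by (auto simp: cl)
        then obtain z where "z \<in> X closure_of R" "e x = e z" by blast
        then show "x \<in> X closure_of R"
          using inj x closure_of_subset_topspace[of X R] by (metis (mono_tags, lifting) inj_onD mem_Collect_eq subsetD)
      qed
      ultimately have "{x \<in> topspace X. e x \<in> ?Q} \<subseteq> X interior_of (X closure_of R)"
        by (intro interior_of_maximal)
      then show ?thesis using rR by auto
    qed
    have "U \<subseteq> Y closure_of (e ` R)"
      using closure[OF U(1)] U closure_of_subset[OF openin_subset[OF U(1)]] by simp
    then have "U \<subseteq> ?Q" using U(1) by (intro interior_of_maximal)
    then have "e ` R \<subseteq> ?Q" using U(2) by blast
    then show "R \<subseteq> e -` ?Q \<inter> topspace X" using RX by blast
  qed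
  show ?thesis
  proof (rule ex1I[of _ ?Q])
    show "?Q \<in> regular_opens Y \<and> e -` ?Q \<inter> topspace X = R"
      using trace mem_regular_opens_interior_closure by blast
    fix Q assume Q: "Q \<in> regular_opens Y \<and> e -` Q \<inter> topspace X = R"
    then have "e ` R = Q \<inter> ?D" by auto
    moreover have "openin Y Q" "Y interior_of (Y closure_of Q) = Q"
      using Q by (auto simp: regular_opens_def)
    ultimately show "Q = ?Q" using closure by simp
  qed
qed

section \<open>The embedding into the Stone-Cech compactification and the separation of
  points\<close>

lemma unit_functions_eq:
  "unit_functions X = mspace (submetric (cfunspace X euclidean_metric) {f. f \<in> topspace X \<rightarrow> {0..1}})"
proof -
  \<comment> \<open>The space \<open>cfunspace\<close> consists of bounded functions, and values in
    the unit interval make this automatic. The equation matches the index set of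
    \<open>completely_regular_space_cube_embedding_explicit\<close>.\<close>
  have "bounded (f ` topspace X)" if "f \<in> topspace X \<rightarrow> {0..1}" for f :: "'a \<Rightarrow> real"
    using that by (intro bounded_subset[OF bounded_closed_interval[of 0 1]]) auto
  then show ?thesis
    by (auto simp: unit_functions_def PiE_def)
qed

lemma sc_unit_image_subset: "sc_unit X ` topspace X \<subseteq> topspace (sc_cube X)"
  by (force simp: sc_cube_def sc_unit_def unit_functions_def)

lemma embedding_map_stone_cech:
  assumes "locally_compact_space X" "Hausdorff_space X"
  shows "embedding_map X (stone_cech X) (sc_unit X)"
proof -
  have "completely_regular_space X"
    using assms locally_compact_regular_imp_completely_regular_space by blast
  then have "embedding_map X (sc_cube X) (sc_unit X)"
    using completely_regular_space_cube_embedding_explicit[of X] assms(2)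
    unfolding sc_cube_def sc_unit_def unit_functions_eq by blast
  moreover have "sc_unit X ` topspace X \<subseteq> sc_cube X closure_of (sc_unit X ` topspace X)"
    by (rule closure_of_subset[OF sc_unit_image_subset])
  ultimately show ?thesis
    by (simp add: stone_cech_def embedding_map_in_subtopology)
qed

lemma dense_stone_cech:
  "stone_cech X closure_of (sc_unit X ` topspace X) = topspace (stone_cech X)"
proof -
  have "sc_unit X ` topspace X \<subseteq> sc_cube X closure_of (sc_unit X ` topspace X)"
    by (rule closure_of_subset[OF sc_unit_image_subset])
  then show ?thesis
    using closure_of_subset_topspace[of "sc_cube X"]
    by (simp add: stone_cech_def closure_of_subtopology Int_absorb1 Int_absorb2)
qed

lemma Hausdorff_stone_cech: "Hausdorff_space (stone_cech X)"
  unfolding stone_cech_def sc_cube_def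
  by (intro Hausdorff_space_subtopology) (simp add: Hausdorff_space_product_topology Hausdorff_space_subtopology)

text \<open>Unique existence, from the dense embedding, gives the description in
  \<open>sc_extension\<close> its meaning.\<close>

lemma sc_extension_trace:
  assumes "locally_compact_space X" "Hausdorff_space X" "R \<in> regular_opens X"
  shows "sc_unit X -` sc_extension X R \<inter> topspace X = R"
  unfolding sc_extension_def
  using theI'[OF dense_embedding_regular_open_extension[OF embedding_map_stone_cech dense_stone_cech], OF assms]
  by blast

text \<open>The images of \<open>x\<close> and \<open>y\<close> in the Hausdorff compactification
  are distinct, so some open set contains only that of \<open>x\<close>. A basic set
  \<open>sc_extension X B\<close> around the image of \<open>x\<close> lies inside it, and its trace
  \<open>B\<close> separates the points.\<close>

lemma generative_separates_points:
  assumes X: "locally_compact_space X" "Hausdorff_space X" and reg: "\<BB> \<subseteq> regular_opens X"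
    and gen: "generative X \<BB>" and xy: "x \<in> topspace X" "y \<in> topspace X" "x \<noteq> y"
  obtains B where "B \<in> \<BB>" "x \<in> B" "y \<notin> B"
proof -
  let ?e = "sc_unit X"
  have h: "homeomorphic_map X (subtopology (stone_cech X) (?e ` topspace X)) ?e"
    using embedding_map_stone_cech[OF X] by (simp add: embedding_map_def)
  have "?e x \<noteq> ?e y"
    using homeomorphic_imp_injective_map[OF h] xy by (auto dest: inj_onD)
  moreover have "?e x \<in> topspace (stone_cech X)" "?e y \<in> topspace (stone_cech X)"
    using homeomorphic_imp_surjective_map[OF h] xy by auto
  ultimately obtain U where U: "openin (stone_cech X) U" "?e x \<in> U" "?e y \<notin> U"
    using Hausdorff_stone_cech[of X] unfolding Hausdorff_space_def disjnt_iff by metis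
  then obtain \<U> where \<U>: "\<U> \<subseteq> sc_extension X ` \<BB>" "\<Union>\<U> = U"
    using gen by (auto simp: generative_def union_of_def arbitrary_def)
  then obtain B where B: "B \<in> \<BB>" "?e x \<in> sc_extension X B" "sc_extension X B \<subseteq> U"
    using U(2) by blast
  have "?e -` sc_extension X B \<inter> topspace X = B"
    using sc_extension_trace[OF X] reg B(1) by blast
  then have "x \<in> B" "y \<notin> B" using B U(3) xy by auto
  then show thesis using that B(1) by simp
qed

section \<open>Stone representations and their morphisms\<close>

locale stone_content =
  fixes C :: "'a content_triple"
  assumes content_space: "content_space C"
begin

sublocale stone_dual C
  using content_space by unfold_locales (simp add: content_space_def)

lemma content: "is_content (pts C) (alg C) (cont C)"
  using content_space by (simp add: content_space_def)

lemma content_nonneg: "B \<in> alg C \<Longrightarrow> 0 \<le> cont C B"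
  using content by (auto simp: is_content_def)

lemma content_list:
  "set Bs \<subseteq> alg C \<Longrightarrow> sorted_wrt disjnt Bs \<Longrightarrow>
    cont C (foldr (ro_join (pts C)) Bs {}) = sum_list (map (cont C) Bs)"
  using content unfolding is_content_def by blast

lemma content_empty: "cont C {} = 0"
  using content_list[of "[]"] by simp

text \<open>The fold over \<open>[A, B]\<close> ends in the join of \<open>B\<close> with the empty
  set, which is \<open>B\<close> by regularity.\<close>

lemma content_join:
  assumes "A \<in> alg C" "B \<in> alg C" "A \<inter> B = {}"
  shows "cont C (ro_join (pts C) A B) = cont C A + cont C B"
  using content_list[of "[A, B]"] assms by (simp add: disjnt_def join_empty)

lemma content_topspace: "cont C (topspace (pts C)) = 1"
  using content_space by (simp add: content_space_def)

lemma disjoint_if_disjoint_star_sets: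
  assumes "A \<in> alg C" "B \<in> alg C" "star_set C A \<inter> star_set C B = {}"
  shows "A \<inter> B = {}"
  using assms inj_onD[OF inj_star_set, of "A \<inter> B" "{}"]
  by (simp add: star_set_Int star_set_empty Int_mem empty_mem)

text \<open>The content transported along the bijection from the algebra onto its star sets;
  \<open>inj_star_set\<close> makes the inverse meaningful.\<close>

definition star_content :: "'a set set set \<Rightarrow> ennreal" where
  "star_content S = ennreal (cont C (inv_into (alg C) (star_set C) S))"

lemma star_content_star_set: "B \<in> alg C \<Longrightarrow> star_content (star_set C B) = ennreal (cont C B)"
  by (simp add: star_content_def inv_into_f_f inj_star_set)

sublocale premeasure: clopen_premeasure "stone_space C" "star_set C ` alg C" star_content
proof (rule clopen_premeasure.intro)
  show "compact_space (stone_space C)" by (rule compact_stone_space)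
  show "algebra (topspace (stone_space C)) (star_set C ` alg C)" by (rule algebra_star_sets)
  show "openin (stone_space C) A" if "A \<in> star_set C ` alg C" for A
    using that openin_star_set by auto
  show "\<exists>A\<in>star_set C ` alg C. x \<in> A \<and> A \<subseteq> U" if "openin (stone_space C) U" "x \<in> U" for U x
    using star_set_base[OF that] by blast
  show "positive (star_set C ` alg C) star_content"
    using star_content_star_set[OF empty_mem] by (simp add: positive_def star_set_empty content_empty)
  show "additive (star_set C ` alg C) star_content"
    unfolding additive_def
  proof safe
    fix A B assume AB: "A \<in> alg C" "B \<in> alg C" "star_set C A \<inter> star_set C B = {}"
    have "star_content (star_set C A \<union> star_set C B) = ennreal (cont C (ro_join (pts C) A B))"
      using AB by (simp add: star_content_star_set join_mem flip: star_set_join)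
    then show "star_content (star_set C A \<union> star_set C B)
        = star_content (star_set C A) + star_content (star_set C B)"
      using AB disjoint_if_disjoint_star_sets[OF AB]
      by (simp add: content_join star_content_star_set content_nonneg)
  qed
  show "star_content (topspace (stone_space C)) \<noteq> \<infinity>"
    using star_content_star_set[OF topspace_mem] by (simp add: star_set_topspace)
qed

lemma prob_space_extension: "prob_space premeasure.extension"
proof
  have "emeasure premeasure.extension (star_set C (topspace (pts C))) = 1"
    using premeasure.emeasure_extension_alg[of "star_set C (topspace (pts C))"]
    by (simp add: topspace_mem star_content_star_set content_topspace)
  then show "emeasure premeasure.extension (space premeasure.extension) = 1"
    by (simp add: premeasure.space_extension star_set_topspace)
qed

text \<open>Resolves the definite description: the extension has the required properties, and
  \<open>extension_unique\<close> excludes any other measure.\<close>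

lemma stone_measure_eq: "stone_measure C = premeasure.extension"
  unfolding stone_measure_def
proof (rule the_equality)
  have "measure premeasure.extension (star_set C B) = cont C B" if "B \<in> alg C" for B
    using that premeasure.emeasure_extension_alg[of "star_set C B"]
    by (simp add: measure_def star_content_star_set content_nonneg)
  then show "borel_probability (stone_space C) premeasure.extension \<and>
      inner_regular (stone_space C) premeasure.extension \<and>
      (\<forall>B\<in>alg C. measure premeasure.extension (star_set C B) = cont C B)"
    using prob_space_extension premeasure.sets_extension premeasure.inner_regular_extension
    by (simp add: borel_probability_def)
next
  fix M assume M: "borel_probability (stone_space C) M \<and> inner_regular (stone_space C) M \<and>
      (\<forall>B\<in>alg C. measure M (star_set C B) = cont C B)"
  then interpret prob_space M by (simp add: borel_probability_def)
  show "M = premeasure.extension"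
  proof (rule premeasure.extension_unique)
    show "emeasure M A = star_content A" if "A \<in> star_set C ` alg C" for A
      using that M by (auto simp: emeasure_eq_measure star_content_star_set)
  qed (use M in \<open>auto simp: borel_probability_def\<close>)
qed

lemma
  shows sets_stone_measure: "sets (stone_measure C) = sigma_sets (topspace (stone_space C)) {U. openin (stone_space C) U}"
    and space_stone_measure: "space (stone_measure C) = topspace (stone_space C)"
    and inner_regular_stone_measure: "inner_regular (stone_space C) (stone_measure C)"
    and borel_probability_stone_measure: "borel_probability (stone_space C) (stone_measure C)"
  by (simp_all only: stone_measure_eq borel_probability_def premeasure.sets_extension
      premeasure.space_extension premeasure.inner_regular_extension prob_space_extension simp_thms)

lemma emeasure_star_set: "B \<in> alg C \<Longrightarrow> emeasure (stone_measure C) (star_set C B) = ennreal (cont C B)"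
  by (simp add: stone_measure_eq premeasure.emeasure_extension_alg star_content_star_set)

lemma stone_measure_unique:
  assumes "inner_regular (stone_space C) M"
    and "sets M = sigma_sets (topspace (stone_space C)) {U. openin (stone_space C) U}"
    and "\<And>B. B \<in> alg C \<Longrightarrow> emeasure M (star_set C B) = ennreal (cont C B)"
  shows "M = stone_measure C"
  unfolding stone_measure_eq
proof (rule premeasure.extension_unique[OF assms(1,2)])
  show "emeasure M A = star_content A" if "A \<in> star_set C ` alg C" for A
    using that assms(3) by (auto simp: star_content_star_set)
qed

lemma stonean_prob_space_stone_rep: "stonean_prob_space (stone_rep C)"
  using stonean_stone_space borel_probability_stone_measure
  by (simp add: stonean_prob_space_def stone_rep_def)

end

lemma inner_regular_distr:
  assumes M: "inner_regular X M" "space M = topspace X" "\<And>U. openin X U \<Longrightarrow> U \<in> sets M"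
    and Y: "Hausdorff_space Y" "space N = topspace Y" "\<And>U. openin Y U \<Longrightarrow> U \<in> sets N"
    and f: "continuous_map X Y f" "f \<in> measurable M N"
  shows "inner_regular Y (distr M N f)"
  unfolding inner_regular_def
proof safe
  fix A assume "A \<in> sets (distr M N f)"
  then have A: "A \<in> sets N" by simp
  let ?P = "f -` A \<inter> space M"
  have P: "?P \<in> sets M" using f(2) A by (rule measurable_sets)
  have "emeasure M K \<le> (SUP L\<in>{L. compactin Y L \<and> L \<subseteq> A}. emeasure (distr M N f) L)"
    if K: "compactin X K" "K \<subseteq> ?P" for K
  proof -
    have L: "compactin Y (f ` K)" "f ` K \<subseteq> A" using image_compactin[OF K(1) f(1)] K(2) by auto
    have "closedin Y (f ` K)" using Y(1) L(1) by (rule compactin_imp_closedin)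
    then have "topspace Y - f ` K \<in> sets N" using Y(3) by auto
    then have LN: "f ` K \<in> sets N"
      using sets.compl_sets[of "topspace Y - f ` K" N] Y(2) compactin_subset_topspace[OF L(1)]
      by (simp add: double_diff)
    have "emeasure M K \<le> emeasure M (f -` (f ` K) \<inter> space M)"
      using K(2) measurable_sets[OF f(2) LN] by (intro emeasure_mono) auto
    also have "\<dots> = emeasure (distr M N f) (f ` K)"
      using f(2) LN by (simp add: emeasure_distr)
    also have "\<dots> \<le> (SUP L\<in>{L. compactin Y L \<and> L \<subseteq> A}. emeasure (distr M N f) L)"
      using L by (intro SUP_upper) auto
    finally show ?thesis .
  qed
  moreover have "emeasure M ?P = (SUP K\<in>{K. compactin X K \<and> K \<subseteq> ?P}. emeasure M K)"
    using M(1) P unfolding inner_regular_def by blast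
  ultimately have "emeasure M ?P \<le> (SUP L\<in>{L. compactin Y L \<and> L \<subseteq> A}. emeasure (distr M N f) L)"
    by (simp only:) (intro SUP_least, blast)
  moreover have "emeasure M ?P = emeasure (distr M N f) A"
    using f(2) A by (simp add: emeasure_distr)
  moreover have "(SUP L\<in>{L. compactin Y L \<and> L \<subseteq> A}. emeasure (distr M N f) L) \<le> emeasure (distr M N f) A"
    using A by (intro SUP_least emeasure_mono) auto
  ultimately show "emeasure (distr M N f) A
      = (SUP L\<in>{L. compactin Y L \<and> L \<subseteq> A}. emeasure (distr M N f) L)"
    by (simp only: antisym)
qed

section \<open>The Stone map of a content morphism: continuity, invariance of measure and
  faithfulness\<close>

locale stone_morphism = C1: stone_content C1 + C2: stone_content C2
  for C1 :: "'a content_triple" and C2 :: "'b content_triple" +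
  fixes \<phi> :: "'a \<Rightarrow> 'b"
  assumes morphism: "content_morphism C1 C2 \<phi>"
begin

lemma continuous: "continuous_map (pts C1) (pts C2) \<phi>"
  using morphism by (simp add: content_morphism_def)

lemma
  shows preimage_mem: "B \<in> alg C2 \<Longrightarrow> content_preimage C1 \<phi> B \<in> alg C1"
    and preimage_compl: "B \<in> alg C2 \<Longrightarrow>
      content_preimage C1 \<phi> (ro_compl (pts C2) B) = ro_compl (pts C1) (content_preimage C1 \<phi> B)"
    and cont_preimage: "B \<in> alg C2 \<Longrightarrow> cont C1 (content_preimage C1 \<phi> B) = cont C2 B"
  using morphism by (auto simp: content_morphism_def boolean_hom_def)

lemma preimage_topspace: "content_preimage C1 \<phi> (topspace (pts C2)) = topspace (pts C1)"
  using continuous_map_image_subset_topspace[OF continuous] by (auto simp: content_preimage_def)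

lemma stone_map_mem_iff:
  "s \<in> ultrafilters (pts C1) (alg C1) \<Longrightarrow>
    B \<in> stone_map C1 C2 \<phi> s \<longleftrightarrow> B \<in> alg C2 \<and> content_preimage C1 \<phi> B \<in> s"
  by (simp add: stone_map_def)

text \<open>Taking preimages preserves inclusions, intersections and \<open>ro_compl\<close>, so the
  filter laws and the alternative between an element and its complement pull back from
  \<open>s\<close>.\<close>

lemma stone_map_ultrafilter:
  assumes s: "s \<in> ultrafilters (pts C1) (alg C1)"
  shows "stone_map C1 C2 \<phi> s \<in> ultrafilters (pts C2) (alg C2)"
proof (rule C2.ultrafilterI)
  note sD = C1.proper_filterD[OF C1.ultrafilterD[OF s]]
  have empty: "content_preimage C1 \<phi> {} = {}" by (simp add: content_preimage_def)
  have Int: "content_preimage C1 \<phi> (A \<inter> B) = content_preimage C1 \<phi> A \<inter> content_preimage C1 \<phi> B" for A B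
    by (auto simp: content_preimage_def)
  have mono: "content_preimage C1 \<phi> A \<subseteq> content_preimage C1 \<phi> B" if "A \<subseteq> B" for A B
    using that by (auto simp: content_preimage_def)
  show "proper_filter (pts C2) (alg C2) (stone_map C1 C2 \<phi> s)"
    unfolding proper_filter_def
  proof (intro conjI ballI impI)
    show "stone_map C1 C2 \<phi> s \<subseteq> alg C2" using s by (auto simp: stone_map_def)
    show "topspace (pts C2) \<in> stone_map C1 C2 \<phi> s"
      using sD(2) by (simp add: stone_map_mem_iff[OF s] preimage_topspace C2.topspace_mem)
    show "{} \<notin> stone_map C1 C2 \<phi> s"
      using sD(3) by (simp add: stone_map_mem_iff[OF s] empty)
    show "A \<inter> B \<in> stone_map C1 C2 \<phi> s"
      if "A \<in> stone_map C1 C2 \<phi> s" "B \<in> stone_map C1 C2 \<phi> s" for A B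
      using that sD(4) by (simp add: stone_map_mem_iff[OF s] Int C2.Int_mem)
    show "B \<in> stone_map C1 C2 \<phi> s"
      if "A \<in> stone_map C1 C2 \<phi> s" "B \<in> alg C2" "A \<subseteq> B" for A B
      using that by (auto simp: stone_map_mem_iff[OF s] intro: sD(5)[OF _ preimage_mem mono])
  qed
  show "B \<in> stone_map C1 C2 \<phi> s \<or> ro_compl (pts C2) B \<in> stone_map C1 C2 \<phi> s" if "B \<in> alg C2" for B
    using that C1.ultrafilter_mem_or_compl[OF s preimage_mem]
    by (simp add: stone_map_mem_iff[OF s] C2.compl_mem preimage_compl)
qed

lemma stone_map_vimage_star_set:
  assumes "B \<in> alg C2"
  shows "stone_map C1 C2 \<phi> -` star_set C2 B \<inter> ultrafilters (pts C1) (alg C1)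
    = star_set C1 (content_preimage C1 \<phi> B)"
  using assms stone_map_ultrafilter by (auto simp: star_set_def stone_map_mem_iff)

lemma continuous_stone_map: "continuous_map (stone_space C1) (stone_space C2) (stone_map C1 C2 \<phi>)"
  unfolding stone_space_def[of C2]
proof (rule continuous_on_generated_topo)
  show "openin (stone_space C1) (stone_map C1 C2 \<phi> -` U \<inter> topspace (stone_space C1))"
    if "U \<in> star_set C2 ` alg C2" for U
    using that stone_map_vimage_star_set C1.openin_star_set[OF preimage_mem] by auto
  show "stone_map C1 C2 \<phi> ` topspace (stone_space C1) \<subseteq> \<Union> (star_set C2 ` alg C2)"
    using stone_map_ultrafilter C2.topspace_mem C2.star_set_topspace by fastforce
qed

lemma measurable_stone_map: "stone_map C1 C2 \<phi> \<in> measurable (stone_measure C1) (stone_measure C2)"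
proof (rule measurable_sigma_sets[OF C2.sets_stone_measure])
  show "{U. openin (stone_space C2) U} \<subseteq> Pow (topspace (stone_space C2))"
    using openin_subset by blast
  show "stone_map C1 C2 \<phi> \<in> space (stone_measure C1) \<rightarrow> topspace (stone_space C2)"
    using stone_map_ultrafilter by (auto simp: C1.space_stone_measure)
  fix U assume "U \<in> {U. openin (stone_space C2) U}"
  then have "openin (stone_space C1) {s \<in> topspace (stone_space C1). stone_map C1 C2 \<phi> s \<in> U}"
    using continuous_stone_map by (intro openin_continuous_map_preimage) auto
  moreover have "{s \<in> topspace (stone_space C1). stone_map C1 C2 \<phi> s \<in> U}
      = stone_map C1 C2 \<phi> -` U \<inter> space (stone_measure C1)"
    by (auto simp: C1.space_stone_measure)
  ultimately show "stone_map C1 C2 \<phi> -` U \<inter> space (stone_measure C1) \<in> sets (stone_measure C1)"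
    unfolding C1.sets_stone_measure by (intro sigma_sets.Basic) simp
qed

text \<open>The push-forward has the right values on star sets because the morphism preserves the
  contents. These values identify the measure only together with inner regularity, which
  \<open>inner_regular_distr\<close> provides.\<close>

lemma distr_stone_map:
  "distr (stone_measure C1) (stone_measure C2) (stone_map C1 C2 \<phi>) = stone_measure C2"
proof (rule C2.stone_measure_unique)
  show "inner_regular (stone_space C2) (distr (stone_measure C1) (stone_measure C2) (stone_map C1 C2 \<phi>))"
    by (rule inner_regular_distr[OF C1.inner_regular_stone_measure C1.space_stone_measure _
          C2.Hausdorff_stone_space C2.space_stone_measure _
          continuous_stone_map measurable_stone_map])
       (auto simp: C1.sets_stone_measure C2.sets_stone_measure)
  show "sets (distr (stone_measure C1) (stone_measure C2) (stone_map C1 C2 \<phi>))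
      = sigma_sets (topspace (stone_space C2)) {U. openin (stone_space C2) U}"
    by (simp add: C2.sets_stone_measure)
  fix B assume B: "B \<in> alg C2"
  then have "star_set C2 B \<in> sets (stone_measure C2)"
    using C2.openin_star_set by (auto simp: C2.sets_stone_measure)
  then show "emeasure (distr (stone_measure C1) (stone_measure C2) (stone_map C1 C2 \<phi>)) (star_set C2 B)
      = ennreal (cont C2 B)"
    using B by (simp add: emeasure_distr measurable_stone_map C1.space_stone_measure
        stone_map_vimage_star_set C1.emeasure_star_set preimage_mem cont_preimage)
qed

lemma measure_preserving_stone_map:
  "measure_preserving (stone_measure C1) (stone_measure C2) (stone_map C1 C2 \<phi>)"
  unfolding measure_preserving_def
proof (intro conjI ballI measurable_stone_map)
  fix A assume "A \<in> sets (stone_measure C2)"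
  then show "emeasure (stone_measure C1) (stone_map C1 C2 \<phi> -` A \<inter> space (stone_measure C1))
      = emeasure (stone_measure C2) A"
    using emeasure_distr[OF measurable_stone_map] by (simp add: distr_stone_map)
qed

lemma stonean_morphism_stone_map: "stonean_morphism (stone_rep C1) (stone_rep C2) (stone_map C1 C2 \<phi>)"
  using continuous_stone_map measure_preserving_stone_map
  by (simp add: stonean_morphism_def stone_rep_def)

end

lemma stone_map_faithful:
  assumes \<phi>: "stone_morphism C1 C2 \<phi>" and \<psi>: "stone_morphism C1 C2 \<psi>"
    and eq: "stone_map C1 C2 \<phi> = stone_map C1 C2 \<psi>" and x: "x \<in> topspace (pts C1)"
  shows "\<phi> x = \<psi> x"
proof (rule ccontr)
  interpret \<phi>: stone_morphism C1 C2 \<phi> by (rule \<phi>)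
  interpret \<psi>: stone_morphism C1 C2 \<psi> by (rule \<psi>)
  assume "\<phi> x \<noteq> \<psi> x"
  moreover have "\<phi> x \<in> topspace (pts C2)" "\<psi> x \<in> topspace (pts C2)"
    using x continuous_map_image_subset_topspace[OF \<phi>.continuous]
      continuous_map_image_subset_topspace[OF \<psi>.continuous] by auto
  moreover have "locally_compact_space (pts C2)" "Hausdorff_space (pts C2)"
    "alg C2 \<subseteq> regular_opens (pts C2)" "generative (pts C2) (alg C2)"
    using \<phi>.C2.content_space by (auto simp: content_space_def boolean_subalgebra_def)
  ultimately obtain B where B: "B \<in> alg C2" "\<phi> x \<in> B" "\<psi> x \<notin> B"
    by (metis generative_separates_points)
  \<comment> \<open>Equal Stone maps put both preimages into the same ultrafilters of
    \<open>alg C1\<close>, and ultrafilters distinguish elements. Yet \<open>x\<close> lies in only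
    one of these preimages.\<close>
  have "content_preimage C1 \<phi> B = content_preimage C1 \<psi> B"
  proof (rule \<phi>.C1.ultrafilters_separate)
    show "content_preimage C1 \<phi> B \<in> s \<longleftrightarrow> content_preimage C1 \<psi> B \<in> s"
      if "s \<in> ultrafilters (pts C1) (alg C1)" for s
      using \<phi>.stone_map_mem_iff[OF that, of B] \<psi>.stone_map_mem_iff[OF that, of B] eq B(1) by simp
  qed (use B(1) \<phi>.preimage_mem \<psi>.preimage_mem in auto)
  then show False using B x by (auto simp: content_preimage_def)
qed

section \<open>Identities and composition in the two categories\<close>

lemma content_preimage_compose:
  assumes "continuous_map (pts C1) (pts C2) \<phi>"
  shows "content_preimage C1 (compose (topspace (pts C1)) \<psi> \<phi>) B
    = content_preimage C1 \<phi> (content_preimage C2 \<psi> B)"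
  using continuous_map_image_subset_topspace[OF assms]
  by (auto simp: content_preimage_def compose_def)

lemma content_preimage_Ident:
  "B \<subseteq> topspace (pts C) \<Longrightarrow> content_preimage C (\<lambda>x\<in>topspace (pts C). x) B = B"
  by (auto simp: content_preimage_def)

lemma continuous_map_compose_extensional:
  "continuous_map X Y f \<Longrightarrow> continuous_map Y Z g \<Longrightarrow> continuous_map X Z (compose (topspace X) g f)"
  by (rule continuous_map_eq[OF continuous_map_compose, of X Y f Z g]) (auto simp: compose_def)

lemma continuous_map_Ident: "continuous_map X X (\<lambda>x\<in>topspace X. x)"
  by (rule continuous_map_eq[OF continuous_map_id]) auto

lemma boolean_hom_comp:
  assumes "boolean_hom X \<BB> Y \<CC> h" "boolean_hom Y \<CC> Z \<DD> k"
    and eq: "\<And>B. l B = k (h B)"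
  shows "boolean_hom X \<BB> Z \<DD> l"
  using assms(1,2) by (simp add: boolean_hom_def eq Pi_iff)

lemma content_morphism_compose:
  assumes "content_morphism C1 C2 \<phi>" "content_morphism C2 C3 \<psi>"
  shows "content_morphism C1 C3 (compose (topspace (pts C1)) \<psi> \<phi>)"
proof -
  have cont: "continuous_map (pts C1) (pts C2) \<phi>" using assms by (simp add: content_morphism_def)
  note pre = content_preimage_compose[OF cont]
  have mem: "content_preimage C2 \<psi> B \<in> alg C2" if "B \<in> alg C3" for B
    using assms(2) that by (auto simp: content_morphism_def boolean_hom_def)
  show ?thesis
    unfolding content_morphism_def
  proof (intro conjI ballI)
    show "continuous_map (pts C1) (pts C3) (compose (topspace (pts C1)) \<psi> \<phi>)"
      using assms by (auto simp: content_morphism_def intro: continuous_map_compose_extensional)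
    show "boolean_hom (pts C3) (alg C3) (pts C1) (alg C1)
        (content_preimage C1 (compose (topspace (pts C1)) \<psi> \<phi>))"
      using assms pre unfolding content_morphism_def by (blast intro: boolean_hom_comp)
    show "cont C1 (content_preimage C1 (compose (topspace (pts C1)) \<psi> \<phi>) B) = cont C3 B"
      if "B \<in> alg C3" for B
      using assms that mem[OF that] by (simp add: pre content_morphism_def)
  qed
qed

lemma content_morphism_Ident:
  assumes "content_space C"
  shows "content_morphism C C (\<lambda>x\<in>topspace (pts C). x)"
proof -
  interpret stone_content C using assms by unfold_locales
  show ?thesis
    using subset_topspace Int_mem join_mem compl_mem
    by (simp add: content_morphism_def continuous_map_Ident boolean_hom_def content_preimage_Ident)
qed

text \<open>The identity laws are literal equations because morphisms are \<open>undefined\<close>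
  off the points of their domain. They and associativity also use that a morphism maps points to
  points of its codomain.\<close>

lemma is_category_Cont: "is_category Cont"
  unfolding is_category_def
proof (intro conjI ballI)
  fix C1 C2 :: "'a content_triple" and \<phi>
  assume "\<phi> \<in> Hom Cont C1 C2"
  then have \<phi>: "\<phi> \<in> extensional (topspace (pts C1))" "\<phi> ` topspace (pts C1) \<subseteq> topspace (pts C2)"
    by (auto simp: Cont_def content_morphism_def dest: continuous_map_image_subset_topspace)
  show "Comp Cont C1 C1 C2 \<phi> (Ident Cont C1) = \<phi>" "Comp Cont C1 C2 C2 (Ident Cont C2) \<phi> = \<phi>"
    using \<phi> by (auto simp: Cont_def compose_def extensional_def fun_eq_iff)
next
  fix C1 C2 C3 C4 :: "'a content_triple" and \<phi> \<psi> \<theta>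
  assume "\<phi> \<in> Hom Cont C1 C2"
  then have "\<phi> ` topspace (pts C1) \<subseteq> topspace (pts C2)"
    by (auto simp: Cont_def content_morphism_def dest: continuous_map_image_subset_topspace)
  then show "Comp Cont C1 C3 C4 \<theta> (Comp Cont C1 C2 C3 \<psi> \<phi>)
      = Comp Cont C1 C2 C4 (Comp Cont C2 C3 C4 \<theta> \<psi>) \<phi>"
    by (auto simp: Cont_def compose_def fun_eq_iff)
qed (auto simp: Cont_def intro: content_morphism_compose content_morphism_Ident)

text \<open>The underlying set of a measure is the largest set of its sigma-algebra, so
  \<open>sets M\<close> determines it.\<close>

lemma borel_probability_space:
  assumes "borel_probability X M"
  shows "space M = topspace X"
proof -
  have sub: "{U. openin X U} \<subseteq> Pow (topspace X)" using openin_subset by blast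
  then have "sets M = sets (sigma (topspace X) {U. openin X U})"
    using assms by (simp add: borel_probability_def)
  then show ?thesis
    using sets_eq_imp_space_eq space_measure_of[OF sub] by metis
qed

text \<open>The measure on \<open>P\<close> lives on the points of the topology of \<open>P\<close>,
  where the restricted composite agrees with the plain one.\<close>

lemma stonean_morphism_compose:
  assumes P: "stonean_prob_space P" and f: "stonean_morphism P Q f" and g: "stonean_morphism Q R g"
  shows "stonean_morphism P R (compose (topspace (fst P)) g f)"
proof -
  have sp: "space (snd P) = topspace (fst P)"
    using P by (simp add: stonean_prob_space_def borel_probability_space)
  let ?h = "compose (topspace (fst P)) g f"
  have mf: "f \<in> measurable (snd P) (snd Q)" and mg: "g \<in> measurable (snd Q) (snd R)"
    using f g by (auto simp: stonean_morphism_def measure_preserving_def)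
  have mh: "?h \<in> measurable (snd P) (snd R)"
    using measurable_compose[OF mf mg] by (subst measurable_cong[where g = "\<lambda>x. g (f x)"]) (auto simp: sp compose_def)
  have "emeasure (snd P) (?h -` A \<inter> space (snd P)) = emeasure (snd R) A" if A: "A \<in> sets (snd R)" for A
  proof -
    have "?h -` A \<inter> space (snd P) = f -` (g -` A \<inter> space (snd Q)) \<inter> space (snd P)"
      using measurable_space[OF mf] by (auto simp: sp compose_def)
    also have "emeasure (snd P) \<dots> = emeasure (snd Q) (g -` A \<inter> space (snd Q))"
      using f measurable_sets[OF mg A] unfolding stonean_morphism_def measure_preserving_def by blast
    also have "\<dots> = emeasure (snd R) A"
      using g A unfolding stonean_morphism_def measure_preserving_def by blast
    finally show ?thesis .
  qed
  then show ?thesis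
    using f g mh by (auto simp: stonean_morphism_def measure_preserving_def
        intro: continuous_map_compose_extensional)
qed

lemma stonean_morphism_Ident:
  assumes P: "stonean_prob_space P"
  shows "stonean_morphism P P (\<lambda>x\<in>topspace (fst P). x)"
proof -
  have sp: "space (snd P) = topspace (fst P)"
    using P by (simp add: stonean_prob_space_def borel_probability_space)
  have "(\<lambda>x\<in>topspace (fst P). x) \<in> measurable (snd P) (snd P)"
    by (subst measurable_cong[where g = "\<lambda>x. x"]) (auto simp: sp)
  moreover have "(\<lambda>x\<in>topspace (fst P). x) -` A \<inter> space (snd P) = A" if "A \<in> sets (snd P)" for A
    using sets.sets_into_space[OF that] by (auto simp: sp)
  ultimately show ?thesis
    by (simp add: stonean_morphism_def measure_preserving_def continuous_map_Ident)
qed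

lemma is_category_StPr: "is_category StPr"
  unfolding is_category_def
proof (intro conjI ballI)
  fix P Q :: "'a top_measure" and f
  assume "f \<in> Hom StPr P Q"
  then have f: "f \<in> extensional (topspace (fst P))" "f ` topspace (fst P) \<subseteq> topspace (fst Q)"
    by (auto simp: StPr_def stonean_morphism_def dest: continuous_map_image_subset_topspace)
  show "Comp StPr P P Q f (Ident StPr P) = f" "Comp StPr P Q Q (Ident StPr Q) f = f"
    using f by (auto simp: StPr_def compose_def extensional_def fun_eq_iff)
next
  fix P Q R S :: "'a top_measure" and f g h
  assume "f \<in> Hom StPr P Q"
  then have "f ` topspace (fst P) \<subseteq> topspace (fst Q)"
    by (auto simp: StPr_def stonean_morphism_def dest: continuous_map_image_subset_topspace)
  then show "Comp StPr P R S h (Comp StPr P Q R g f) = Comp StPr P Q S (Comp StPr Q R S h g) f"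
    by (auto simp: StPr_def compose_def fun_eq_iff)
qed (auto simp: StPr_def intro: stonean_morphism_compose stonean_morphism_Ident)

section \<open>Functor laws and the final assembly\<close>

lemma stone_map_Ident:
  assumes "content_space C"
  shows "stone_map C C (\<lambda>x\<in>topspace (pts C). x) = (\<lambda>s\<in>ultrafilters (pts C) (alg C). s)"
proof -
  interpret stone_content C using assms by unfold_locales
  show ?thesis
    unfolding stone_map_def
  proof (rule restrict_ext)
    fix s assume s: "s \<in> ultrafilters (pts C) (alg C)"
    show "{B \<in> alg C. content_preimage C (\<lambda>x\<in>topspace (pts C). x) B \<in> s} = s"
      using proper_filterD(1)[OF ultrafilterD[OF s]] subset_topspace
      by (auto simp: content_preimage_Ident)
  qed
qed

text \<open>On an ultrafilter \<open>s\<close> both sides collect the \<open>B\<close> whose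
  preimage, first under \<open>\<psi>\<close> and then under \<open>\<phi>\<close>, belongs to
  \<open>s\<close>; elsewhere both are \<open>undefined\<close>.\<close>

lemma stone_map_compose:
  assumes \<phi>: "stone_morphism C1 C2 \<phi>" and \<psi>: "stone_morphism C2 C3 \<psi>"
  shows "stone_map C1 C3 (compose (topspace (pts C1)) \<psi> \<phi>)
    = compose (ultrafilters (pts C1) (alg C1)) (stone_map C2 C3 \<psi>) (stone_map C1 C2 \<phi>)"
proof
  interpret \<phi>: stone_morphism C1 C2 \<phi> by (rule \<phi>)
  interpret \<psi>: stone_morphism C2 C3 \<psi> by (rule \<psi>)
  fix s
  show "stone_map C1 C3 (compose (topspace (pts C1)) \<psi> \<phi>) s
    = compose (ultrafilters (pts C1) (alg C1)) (stone_map C2 C3 \<psi>) (stone_map C1 C2 \<phi>) s"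
  proof (cases "s \<in> ultrafilters (pts C1) (alg C1)")
    case True
    then show ?thesis
      using \<psi>.stone_map_mem_iff[OF \<phi>.stone_map_ultrafilter[OF True]]
        \<phi>.stone_map_mem_iff[OF True] \<psi>.preimage_mem
      by (auto simp: compose_eq stone_map_def[of C1 C3] content_preimage_compose[OF \<phi>.continuous])
  qed (simp add: stone_map_def compose_def)
qed

lemma faithful_functor_stone: "faithful_functor Cont StPr stone_rep stone_map"
proof -
  have mor: "stone_morphism C1 C2 \<phi>"
    if "C1 \<in> Obj Cont" "C2 \<in> Obj Cont" "\<phi> \<in> Hom Cont C1 C2" for C1 C2 :: "'a content_triple" and \<phi>
    using that by unfold_locales (auto simp: Cont_def)
  \<comment> \<open>Morphisms of \<open>StPr\<close> are restricted to the points of the Stone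
    space, while \<open>stone_map\<close> is restricted to ultrafilters; identifying the two sets
    turns the functor laws into literal equations.\<close>
  have space: "topspace (fst (stone_rep C)) = ultrafilters (pts C) (alg C)"
    if "C \<in> Obj Cont" for C :: "'a content_triple"
  proof -
    interpret stone_content C using that by unfold_locales (auto simp: Cont_def)
    show ?thesis by (simp add: stone_rep_def)
  qed
  have "is_functor Cont StPr stone_rep (stone_map :: 'a content_triple \<Rightarrow> _)"
    unfolding is_functor_def
  proof (intro conjI ballI is_category_Cont is_category_StPr)
    fix C1 :: "'a content_triple" assume C1: "C1 \<in> Obj Cont"
    then interpret C1: stone_content C1 by unfold_locales (auto simp: Cont_def)
    show "stone_rep C1 \<in> Obj StPr"
      using C1.stonean_prob_space_stone_rep by (simp add: StPr_def)
    show "stone_map C1 C1 (Ident Cont C1) = Ident StPr (stone_rep C1)"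
      using stone_map_Ident[OF C1.content_space] by (simp add: Cont_def StPr_def stone_rep_def)
    fix C2 \<phi> assume C2: "C2 \<in> Obj Cont" and \<phi>: "\<phi> \<in> Hom Cont C1 C2"
    interpret \<phi>: stone_morphism C1 C2 \<phi> by (rule mor[OF C1 C2 \<phi>])
    show "stone_map C1 C2 \<phi> \<in> Hom StPr (stone_rep C1) (stone_rep C2)"
      using \<phi>.stonean_morphism_stone_map space[OF C1] by (simp add: StPr_def stone_map_def)
    fix C3 \<psi> assume C3: "C3 \<in> Obj Cont" and \<psi>: "\<psi> \<in> Hom Cont C2 C3"
    show "stone_map C1 C3 (Comp Cont C1 C2 C3 \<psi> \<phi>)
        = Comp StPr (stone_rep C1) (stone_rep C2) (stone_rep C3) (stone_map C2 C3 \<psi>) (stone_map C1 C2 \<phi>)"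
      using stone_map_compose[OF mor[OF C1 C2 \<phi>] mor[OF C2 C3 \<psi>]] space[OF C1]
      by (simp add: Cont_def StPr_def)
  qed
  moreover have "inj_on (stone_map C1 C2) (Hom Cont C1 C2)"
    if C: "C1 \<in> Obj Cont" "C2 \<in> Obj Cont" for C1 C2 :: "'a content_triple"
  proof (rule inj_onI)
    fix \<phi> \<psi> assume *: "\<phi> \<in> Hom Cont C1 C2" "\<psi> \<in> Hom Cont C1 C2"
      and eq: "stone_map C1 C2 \<phi> = stone_map C1 C2 \<psi>"
    have "\<phi> \<in> extensional (topspace (pts C1))" "\<psi> \<in> extensional (topspace (pts C1))"
      using * by (auto simp: Cont_def)
    then show "\<phi> = \<psi>"
      using stone_map_faithful[OF mor[OF C *(1)] mor[OF C *(2)] eq] by (rule extensionalityI)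
  qed
  ultimately show ?thesis by (simp add: faithful_functor_def)
qed

text \<open>All objects of one category share a point type, so the claim about a single morphism is
  a separate conjunct that allows two different point types.\<close>

theorem proposition9p2:
  shows
    "(\<forall>(C1 :: 'a content_triple) (C2 :: 'b content_triple) (\<phi> :: 'a \<Rightarrow> 'b).
        content_space C1 \<and> content_space C2 \<and> content_morphism C1 C2 \<phi> \<longrightarrow>
          continuous_map (stone_space C1) (stone_space C2) (stone_map C1 C2 \<phi>) \<and>
          measure_preserving (stone_measure C1) (stone_measure C2) (stone_map C1 C2 \<phi>)) \<and>
     faithful_functor (Cont :: ('u content_triple, 'u \<Rightarrow> 'u) cat) StPr stone_rep stone_map"
proof (intro conjI allI impI faithful_functor_stone; elim conjE)
  fix C1 :: "'a content_triple" and C2 :: "'b content_triple" and \<phi> :: "'a \<Rightarrow> 'b"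
  assume "content_space C1" "content_space C2" "content_morphism C1 C2 \<phi>"
  then interpret stone_morphism C1 C2 \<phi> by unfold_locales
  show "continuous_map (stone_space C1) (stone_space C2) (stone_map C1 C2 \<phi>)"
    by (rule continuous_stone_map)
  show "measure_preserving (stone_measure C1) (stone_measure C2) (stone_map C1 C2 \<phi>)"
    by (rule measure_preserving_stone_map)
qed

end
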